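(* Let $T>0$ and let $X=\{X_t\}_{t\in[0,T]}$ be a real-valued continuous semimartingale, with decomposition $X_t=X_0+M_t+A_t$, where $M$ is a continuous local martingale with $M_0=0$ and $A$ is a continuous process of finite variation with $A_0=0$. Let $\langle X\rangle$ denote the quadratic variation process of $X$. Then, almost surely, as $c\searrow 0$, $$c\,\mathrm{TV}^c(X,t)\to \langle X\rangle_t,\qquad c\,\mathrm{UTV}^c(X,t)\to \tfrac12\langle X\rangle_t,\qquad c\,\mathrm{DTV}^c(X,t)\to \tfrac12\langle X\rangle_t,$$ where in all three cases the convergence is that of the functions of $t\in[0,T]$ in $\mathcal{C}([0,T],\mathbb{R})$, i.e. uniformly in $t\in[0,T]$.
   Context: For $c\ge 0$ let $\phi_c(x)=\max\{x-c,0\}$. For a càdlàg function $f:[a,b]\to\mathbb{R}$ define the truncated variation, upward truncated variation and downward truncated variation by $$\mathrm{TV}^c(f,[a,b])=\sup_n\ \sup_{a\le t_1<t_2<\dots<t_n\le b}\ \sum_{i=1}^{n-1}\phi_c(|f(t_{i+1})-f(t_i)|),$$ $$\mathrm{UTV}^c(f,[a,b])=\sup_n\ \sup_{a\le t_1<s_1<t_2<s_2<\dots<t_n<s_n\le b}\ \sum_{i=1}^{n}\phi_c(f(s_i)-f(t_i)),$$ $$\mathrm{DTV}^c(f,[a,b])=\sup_n\ \sup_{a\le t_1<s_1<t_2<s_2<\dots<t_n<s_n\le b}\ \sum_{i=1}^{n}\phi_c(f(t_i)-f(s_i))$$ (all are $0$ when $a=b$). For a càdlàg process $X$ put, pathwise,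 $\mathrm{TV}^c(X,t)=\mathrm{TV}^c(X,[0,t])$, $\mathrm{UTV}^c(X,t)=\mathrm{UTV}^c(X,[0,t])$, $\mathrm{DTV}^c(X,t)=\mathrm{DTV}^c(X,[0,t])$. $\mathcal{C}([0,T],\mathbb{R})$ is the space of continuous functions on $[0,T]$ with the supremum norm. *)

theory Defs
  imports "HOL-Probability.Probability"
begin

section \<open>Truncated variation\<close>

definition trunc :: "real \<Rightarrow> real \<Rightarrow> real"
  where "trunc c x = max (x - c) 0"

text \<open>
  Finite sequences are given by their length \<open>n\<close> and a function whose values matter only on
  \<open>{1..n}\<close>. Length 0 is allowed, so both sets below are nonempty and suprema over them in
  \<^typ>\<open>ennreal\<close> are \<open>0\<close> when \<open>a = b\<close>.
\<close>

definition increasing_points :: "real \<Rightarrow> real \<Rightarrow> (nat \<times> (nat \<Rightarrow> real)) set"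
  where "increasing_points a b = {(n, t). t ` {1..n} \<subseteq> {a..b} \<and> strict_mono_on {1..n} t}"

definition alternating_points ::
    "real \<Rightarrow> real \<Rightarrow> (nat \<times> (nat \<Rightarrow> real) \<times> (nat \<Rightarrow> real)) set"
  where "alternating_points a b = {(n, t, s).
     t ` {1..n} \<subseteq> {a..b} \<and> s ` {1..n} \<subseteq> {a..b} \<and>
     (\<forall>i\<in>{1..n}. t i < s i) \<and> (\<forall>i\<in>{1..<n}. s i < t (Suc i))}"

definition truncated_variation :: "real \<Rightarrow> (real \<Rightarrow> real) \<Rightarrow> real \<Rightarrow> real \<Rightarrow> ennreal"
  where "truncated_variation c f a b =
    (SUP (n, t) \<in> increasing_points a b.
       ennreal (\<Sum>i = 1..<n. trunc c \<bar>f (t (Suc i)) - f (t i)\<bar>))"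

definition up_truncated_variation :: "real \<Rightarrow> (real \<Rightarrow> real) \<Rightarrow> real \<Rightarrow> real \<Rightarrow> ennreal"
  where "up_truncated_variation c f a b =
    (SUP (n, t, s) \<in> alternating_points a b.
       ennreal (\<Sum>i = 1..n. trunc c (f (s i) - f (t i))))"

definition down_truncated_variation :: "real \<Rightarrow> (real \<Rightarrow> real) \<Rightarrow> real \<Rightarrow> real \<Rightarrow> ennreal"
  where "down_truncated_variation c f a b =
    (SUP (n, t, s) \<in> alternating_points a b.
       ennreal (\<Sum>i = 1..n. trunc c (f (t i) - f (s i))))"

text \<open>
  For \<open>c = 0\<close> the truncated variation is the total variation, which may be infinite. For
  \<open>c > 0\<close> and continuous \<open>f\<close> all three quantities are finite, so that \<^const>\<open>enn2real\<close> does
  not alter them.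
\<close>

definition finite_variation_on :: "(real \<Rightarrow> real) \<Rightarrow> real \<Rightarrow> real \<Rightarrow> bool"
  where "finite_variation_on f a b \<longleftrightarrow> truncated_variation 0 f a b < \<infinity>"

lemma trunc_mono: "x \<le> y \<Longrightarrow> trunc c x \<le> trunc c y"
  by (auto simp: trunc_def)

lemma trunc_increment_bound:
  fixes f :: "real \<Rightarrow> real"
  assumes "0 < c" and f: "continuous_on {a..b} f"
  obtains C where "0 \<le> C"
    and "\<And>x y. x \<in> {a..b} \<Longrightarrow> y \<in> {a..b} \<Longrightarrow> x \<le> y \<Longrightarrow> trunc c \<bar>f y - f x\<bar> \<le> C * (y - x)"
proof -
  have "uniformly_continuous_on {a..b} f"
    using f compact_uniformly_continuous by blast
  then obtain d where d: "d > 0"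
      "\<And>x y. x \<in> {a..b} \<Longrightarrow> y \<in> {a..b} \<Longrightarrow> dist y x < d \<Longrightarrow> dist (f y) (f x) < c"
    using \<open>0 < c\<close> unfolding uniformly_continuous_on_def by metis
  have "bounded (f ` {a..b})"
    using f by (intro compact_imp_bounded compact_continuous_image) auto
  then obtain K where K: "K > 0" "\<And>x. x \<in> {a..b} \<Longrightarrow> \<bar>f x\<bar> \<le> K"
    by (auto simp: bounded_pos)
  show ?thesis
  proof (rule that[of "2 * K / d"])
    show "0 \<le> 2 * K / d" using d K by simp
    fix x y assume xy: "x \<in> {a..b}" "y \<in> {a..b}" "x \<le> y"
    show "trunc c \<bar>f y - f x\<bar> \<le> 2 * K / d * (y - x)"
    proof (cases "y - x < d")
      case True
      then have "\<bar>f y - f x\<bar> < c" using d(2)[of x y] xy by (auto simp: dist_real_def)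
      then show ?thesis using d K xy by (simp add: trunc_def)
    next
      case False
      then have "2 * K * d \<le> 2 * K * (y - x)" using K by simp
      then have "2 * K \<le> 2 * K / d * (y - x)" using d by (simp add: field_simps)
      moreover have "trunc c \<bar>f y - f x\<bar> \<le> 2 * K"
        using K(2)[of x] K(2)[of y] xy \<open>0 < c\<close> K(1) by (simp add: trunc_def)
      ultimately show ?thesis by linarith
    qed
  qed
qed

lemma truncated_variation_finite:
  assumes "0 < c" "continuous_on {a..b} f"
  shows "truncated_variation c f a b < \<infinity>"
proof -
  obtain C where C: "0 \<le> C"
    "\<And>x y. x \<in> {a..b} \<Longrightarrow> y \<in> {a..b} \<Longrightarrow> x \<le> y \<Longrightarrow> trunc c \<bar>f y - f x\<bar> \<le> C * (y - x)"
    using trunc_increment_bound[OF assms] by blast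
  have "truncated_variation c f a b \<le> ennreal (C * \<bar>b - a\<bar>)"
    unfolding truncated_variation_def
  proof (rule SUP_least, clarify, rule ennreal_leI)
    fix n t assume nt: "(n, t) \<in> increasing_points a b"
    have "(\<Sum>i = 1..<n. trunc c \<bar>f (t (Suc i)) - f (t i)\<bar>) \<le> (\<Sum>i = 1..<n. C * (t (Suc i) - t i))"
    proof (rule sum_mono)
      fix i assume i: "i \<in> {1..<n}"
      have "t i < t (Suc i)"
        using nt i by (auto simp: increasing_points_def strict_mono_on_def)
      moreover have "t i \<in> {a..b}" "t (Suc i) \<in> {a..b}"
        using nt i by (auto simp: increasing_points_def image_subset_iff)
      ultimately show "trunc c \<bar>f (t (Suc i)) - f (t i)\<bar> \<le> C * (t (Suc i) - t i)"
        using C(2)[of "t i" "t (Suc i)"] by simp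
    qed
    also have "\<dots> = C * (\<Sum>i = 1..<n. t (Suc i) - t i)"
      by (simp add: sum_distrib_left)
    also have "\<dots> \<le> C * \<bar>b - a\<bar>"
    proof (rule mult_left_mono)
      show "(\<Sum>i = 1..<n. t (Suc i) - t i) \<le> \<bar>b - a\<bar>"
      proof (cases "1 \<le> n")
        case True
        then have "t 1 \<in> {a..b}" "t n \<in> {a..b}"
          using nt by (auto simp: increasing_points_def image_subset_iff)
        then show ?thesis using True sum_Suc_diff'[of 1 n t] by auto
      qed simp
    qed (use C in auto)
    finally show "(\<Sum>i = 1..<n. trunc c \<bar>f (t (Suc i)) - f (t i)\<bar>) \<le> C * \<bar>b - a\<bar>" .
  qed
  then show ?thesis by (simp add: order_le_less_trans)
qed

lemma alternating_points_sum_le: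
  assumes "(n, t, s) \<in> alternating_points a b"
  shows "(\<Sum>i = 1..n. s i - t i) \<le> \<bar>b - a\<bar>"
proof (cases "1 \<le> n")
  case True
  have "(\<Sum>i = 1..m. s i - t i) \<le> s m - a" if "1 \<le> m" "m \<le> n" for m
    using that
  proof (induction m rule: nat_induct_at_least)
    case base
    then have "t 1 \<in> {a..b}" using assms by (auto simp: alternating_points_def image_subset_iff)
    then show ?case by simp
  next
    case (Suc m)
    then have "s m < t (Suc m)" using assms by (auto simp: alternating_points_def)
    then show ?case using Suc by simp
  qed
  from this[of n] have "(\<Sum>i = 1..n. s i - t i) \<le> s n - a" using True by simp
  moreover have "s n \<in> {a..b}"
    using assms True by (auto simp: alternating_points_def image_subset_iff)
  ultimately show ?thesis by auto
qed simp

lemma alternating_sum_le: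
  assumes "0 \<le> C" "(n, t, s) \<in> alternating_points a b"
    and g: "\<And>x y. x \<in> {a..b} \<Longrightarrow> y \<in> {a..b} \<Longrightarrow> x \<le> y \<Longrightarrow> g x y \<le> C * (y - x)"
  shows "(\<Sum>i = 1..n. g (t i) (s i)) \<le> C * \<bar>b - a\<bar>"
proof -
  have "(\<Sum>i = 1..n. g (t i) (s i)) \<le> (\<Sum>i = 1..n. C * (s i - t i))"
  proof (intro sum_mono g)
    fix i assume i: "i \<in> {1..n}"
    show "t i \<in> {a..b}" "s i \<in> {a..b}" "t i \<le> s i"
      using assms(2) i by (auto simp: alternating_points_def image_subset_iff less_imp_le)
  qed
  also have "\<dots> = C * (\<Sum>i = 1..n. s i - t i)"
    by (simp add: sum_distrib_left)
  also have "\<dots> \<le> C * \<bar>b - a\<bar>"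
    using alternating_points_sum_le[OF assms(2)] assms(1) by (rule mult_left_mono)
  finally show ?thesis .
qed

lemma up_truncated_variation_finite:
  assumes "0 < c" "continuous_on {a..b} f"
  shows "up_truncated_variation c f a b < \<infinity>"
proof -
  obtain C where C: "0 \<le> C"
    "\<And>x y. x \<in> {a..b} \<Longrightarrow> y \<in> {a..b} \<Longrightarrow> x \<le> y \<Longrightarrow> trunc c \<bar>f y - f x\<bar> \<le> C * (y - x)"
    using trunc_increment_bound[OF assms] by blast
  have C': "trunc c (f y - f x) \<le> C * (y - x)"
    if "x \<in> {a..b}" "y \<in> {a..b}" "x \<le> y" for x y
    using C(2)[OF that] trunc_mono[of "f y - f x" "\<bar>f y - f x\<bar>" c] by linarith
  have "up_truncated_variation c f a b \<le> ennreal (C * \<bar>b - a\<bar>)"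
    unfolding up_truncated_variation_def
    by (rule SUP_least, clarify, rule ennreal_leI)
       (rule alternating_sum_le[OF C(1), where g = "\<lambda>x y. trunc c (f y - f x)"], auto intro: C')
  then show ?thesis by (simp add: order_le_less_trans)
qed

lemma down_truncated_variation_finite:
  assumes "0 < c" "continuous_on {a..b} f"
  shows "down_truncated_variation c f a b < \<infinity>"
proof -
  have "down_truncated_variation c f a b = up_truncated_variation c (\<lambda>x. - f x) a b"
    by (simp add: down_truncated_variation_def up_truncated_variation_def)
  then show ?thesis
    using up_truncated_variation_finite[OF assms(1), of a b "\<lambda>x. - f x"] assms(2)
    by (simp add: continuous_on_minus)
qed


section \<open>Continuous semimartingales on a bounded time interval\<close>

text \<open>
  A process on \<open>[0, T]\<close> is a function \<open>real \<Rightarrow> 'a \<Rightarrow> real\<close> of which only the values at times in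
  \<open>{0..T}\<close> are used. No completeness or right-continuity of the filtration is required.
\<close>

definition filtered_prob_space :: "'a measure \<Rightarrow> (real \<Rightarrow> 'a measure) \<Rightarrow> bool"
  where "filtered_prob_space P F \<longleftrightarrow>
    prob_space P \<and> filtration (space P) F \<and> (\<forall>t. subalgebra P (F t))"

definition adapted :: "(real \<Rightarrow> 'a measure) \<Rightarrow> real \<Rightarrow> (real \<Rightarrow> 'a \<Rightarrow> real) \<Rightarrow> bool"
  where "adapted F T Y \<longleftrightarrow> (\<forall>t\<in>{0..T}. Y t \<in> borel_measurable (F t))"

definition continuous_paths :: "'a measure \<Rightarrow> real \<Rightarrow> (real \<Rightarrow> 'a \<Rightarrow> real) \<Rightarrow> bool"
  where "continuous_paths P T Y \<longleftrightarrow> (\<forall>\<omega>\<in>space P. continuous_on {0..T} (\<lambda>t. Y t \<omega>))"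

definition martingale ::
    "'a measure \<Rightarrow> (real \<Rightarrow> 'a measure) \<Rightarrow> real \<Rightarrow> (real \<Rightarrow> 'a \<Rightarrow> real) \<Rightarrow> bool"
  where "martingale P F T Y \<longleftrightarrow>
    adapted F T Y \<and>
    (\<forall>t\<in>{0..T}. integrable P (Y t)) \<and>
    (\<forall>s\<in>{0..T}. \<forall>t\<in>{s..T}. AE \<omega> in P. real_cond_exp P (F s) (Y t) \<omega> = Y s \<omega>)"

text \<open>
  Since the time interval is closed, a localizing sequence is one that almost surely reaches
  \<open>T\<close> after finitely many steps.
\<close>

definition localizing_sequence ::
    "'a measure \<Rightarrow> (real \<Rightarrow> 'a measure) \<Rightarrow> real \<Rightarrow> (nat \<Rightarrow> 'a \<Rightarrow> real) \<Rightarrow> bool"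
  where "localizing_sequence P F T \<tau> \<longleftrightarrow>
    (\<forall>n. stopping_time F (\<tau> n)) \<and>
    (\<forall>n. \<forall>\<omega>\<in>space P. \<tau> n \<omega> \<in> {0..T}) \<and>
    (AE \<omega> in P. incseq (\<lambda>n. \<tau> n \<omega>)) \<and>
    (AE \<omega> in P. \<forall>\<^sub>F n in sequentially. \<tau> n \<omega> = T)"

definition continuous_local_martingale ::
    "'a measure \<Rightarrow> (real \<Rightarrow> 'a measure) \<Rightarrow> real \<Rightarrow> (real \<Rightarrow> 'a \<Rightarrow> real) \<Rightarrow> bool"
  where "continuous_local_martingale P F T Y \<longleftrightarrow>
    adapted F T Y \<and> continuous_paths P T Y \<and>
    (\<exists>\<tau>. localizing_sequence P F T \<tau> \<and>
         (\<forall>n. martingale P F T (\<lambda>t \<omega>. Y (min t (\<tau> n \<omega>)) \<omega>)))"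

definition continuous_finite_variation_process ::
    "'a measure \<Rightarrow> (real \<Rightarrow> 'a measure) \<Rightarrow> real \<Rightarrow> (real \<Rightarrow> 'a \<Rightarrow> real) \<Rightarrow> bool"
  where "continuous_finite_variation_process P F T Y \<longleftrightarrow>
    adapted F T Y \<and> continuous_paths P T Y \<and>
    (\<forall>\<omega>\<in>space P. finite_variation_on (\<lambda>t. Y t \<omega>) 0 T)"

definition continuous_semimartingale_decomposition ::
    "'a measure \<Rightarrow> (real \<Rightarrow> 'a measure) \<Rightarrow> real \<Rightarrow>
     (real \<Rightarrow> 'a \<Rightarrow> real) \<Rightarrow> (real \<Rightarrow> 'a \<Rightarrow> real) \<Rightarrow> (real \<Rightarrow> 'a \<Rightarrow> real) \<Rightarrow> bool"
  where "continuous_semimartingale_decomposition P F T X M A \<longleftrightarrow>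
    adapted F T X \<and> continuous_paths P T X \<and>
    continuous_local_martingale P F T M \<and> (AE \<omega> in P. M 0 \<omega> = 0) \<and>
    continuous_finite_variation_process P F T A \<and> (AE \<omega> in P. A 0 \<omega> = 0) \<and>
    (AE \<omega> in P. \<forall>t\<in>{0..T}. X t \<omega> = X 0 \<omega> + M t \<omega> + A t \<omega>)"

definition time_partition :: "real \<Rightarrow> nat \<Rightarrow> (nat \<Rightarrow> real) \<Rightarrow> bool"
  where "time_partition t n p \<longleftrightarrow> p 0 = 0 \<and> p n = t \<and> (\<forall>i<n. p i \<le> p (Suc i))"

text \<open>
  \<open>Q\<close> is the continuous version of the quadratic variation process of \<open>X\<close>: for each \<open>t\<close>, the
  sums of squared increments of \<open>X\<close> along partitions of \<open>[0, t]\<close> converge to \<open>Q t\<close> in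
  probability as the mesh tends to \<open>0\<close>. This determines \<open>Q\<close> up to indistinguishability; in
  particular \<open>Q 0 = 0\<close> and monotonicity hold almost surely without being required.
\<close>

definition is_quadratic_variation ::
    "'a measure \<Rightarrow> real \<Rightarrow> (real \<Rightarrow> 'a \<Rightarrow> real) \<Rightarrow> (real \<Rightarrow> 'a \<Rightarrow> real) \<Rightarrow> bool"
  where "is_quadratic_variation P T X Q \<longleftrightarrow>
    (\<forall>t\<in>{0..T}. Q t \<in> borel_measurable P) \<and> continuous_paths P T Q \<and>
    (\<forall>t\<in>{0..T}. \<forall>\<epsilon>>0. \<forall>\<eta>>0. \<exists>\<delta>>0. \<forall>n p.
       time_partition t n p \<and> (\<forall>i<n. p (Suc i) - p i < \<delta>) \<longrightarrow>
       measure P {\<omega> \<in> space P.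
         \<bar>(\<Sum>i<n. (X (p (Suc i)) \<omega> - X (p i) \<omega>)\<^sup>2) - Q t \<omega>\<bar> > \<epsilon>} < \<eta>)"

end

theory Submission
  imports Defs
begin

text \<open>
  Let a path \<open>g\<close> follow \<open>X\<close> lazily: it starts at \<open>X 0\<close> and moves only when it must in order to stay
  within \<open>c / 2\<close> of \<open>X\<close>. The variation of \<open>g\<close> is the truncated variation of \<open>X\<close> at level \<open>c\<close>, up to
  an error of order \<open>c\<close>: whenever \<open>X\<close> makes a move larger than \<open>c\<close>, \<open>g\<close> has to make up for the
  excess (\<open>sum_trunc_le_rise\<close>), and conversely every monotone run of \<open>g\<close> but the first is a move of
  \<open>X\<close> shortened by \<open>c\<close> (\<open>weighted_play_variation_le\<close>).

  Sample \<open>X\<close> on a fine grid and put \<open>u = X - g\<close>. As \<open>g\<close> moves only while \<open>u\<close> sits at an end point of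
  \<open>[- c / 2, c / 2]\<close>, and then in the direction of the sign of \<open>u\<close>, elementary algebra gives the exact
  identity (\<open>play_identity\<close>)
  \<open>c * (\<Sum> |\<Delta> g|) = (\<Sum> (\<Delta> X)\<^sup>2) + 2 * (\<Sum> u * \<Delta> X) - (\<Sum> (\<Delta> g)\<^sup>2) - u\<^bsub>end\<^esub>\<^sup>2\<close>.
  The first sum on the right tends to the quadratic variation as the mesh shrinks, the sum of
  \<open>(\<Delta> g)\<^sup>2\<close> vanishes because \<open>X\<close> is continuous, and the last term is of order \<open>c\<^sup>2\<close>. In the remaining
  sum the coefficient \<open>2 u\<close> is at most \<open>c\<close> in absolute value and is known before the increment
  \<open>\<Delta> X\<close>. The finite variation part of \<open>X\<close> therefore contributes at most \<open>c\<close> times its variation. The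
  local martingale part contributes a martingale transform with coefficients bounded by \<open>c\<close>, and
  such a transform exceeds a given bound with probability \<open>O(c)\<close>, after localization
  (\<open>martingale_transform_prob_le\<close>). These probabilities are summable along \<open>c = 1 / k\<^sup>2\<close>, so that
  the Borel-Cantelli lemma yields almost sure convergence along these levels at each fixed time.

  The limit over the grids causes no trouble: a single sufficiently fine grid already determines
  \<open>c\<close> times the truncated variation up to \<open>O(c\<^sup>2)\<close>. So it suffices that infinitely many grids are
  good, and by Fatou's lemma the probability that all but finitely many are bad obeys the same bound
  as that of a single bad grid.

  For the upward and the downward quantity, \<open>\<Sum> |\<Delta> g|\<close> is the sum of the rise and the fall of \<open>g\<close>,
  whose difference is \<open>g\<^bsub>end\<^esub> - g 0\<close>. It stays bounded, so it is negligible after multiplication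
  with \<open>c\<close>, and each half of the variation tends to half of the quadratic variation.

  All three quantities are monotone in the level and in time. As the ratio of consecutive levels
  \<open>1 / k\<^sup>2\<close> tends to \<open>1\<close>, convergence along these levels extends to \<open>c \<rightarrow> 0\<close>, and convergence at
  countably many times to a continuous limit extends to uniform convergence.
\<close>

section \<open>The play operator\<close>

text \<open>
  The discrete play (hysteresis) operator: the new value is the projection of the old one onto the
  interval of radius \<open>r\<close> about the input.
\<close>

primrec play :: "real \<Rightarrow> (nat \<Rightarrow> real) \<Rightarrow> nat \<Rightarrow> real"
  where
    "play r x 0 = x 0"
  | "play r x (Suc n) = max (x (Suc n) - r) (min (x (Suc n) + r) (play r x n))"

definition rise :: "(nat \<Rightarrow> real) \<Rightarrow> nat \<Rightarrow> real"
  where "rise g n = (\<Sum>i<n. max 0 (g (Suc i) - g i))"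

definition fall :: "(nat \<Rightarrow> real) \<Rightarrow> nat \<Rightarrow> real"
  where "fall g n = (\<Sum>i<n. max 0 (g i - g (Suc i)))"

lemma rise_plus_fall: "rise g n + fall g n = (\<Sum>i<n. \<bar>g (Suc i) - g i\<bar>)"
  unfolding rise_def fall_def sum.distrib[symmetric] by (rule sum.cong) auto

lemma rise_minus_fall: "rise g n - fall g n = g n - g 0"
proof -
  have "rise g n - fall g n = (\<Sum>i<n. g (Suc i) - g i)"
    unfolding rise_def fall_def sum_subtractf[symmetric] by (rule sum.cong) auto
  then show ?thesis by (simp add: sum_lessThan_telescope)
qed

lemma rise_nonneg: "0 \<le> rise g n"
  by (auto simp: rise_def intro!: sum_nonneg)

lemma play_close: "0 \<le> r \<Longrightarrow> \<bar>x n - play r x n\<bar> \<le> r"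
  by (cases n) auto

lemma play_uminus: "0 \<le> r \<Longrightarrow> play r (\<lambda>i. - x i) n = - play r x n"
  by (induction n) (auto simp: max_def min_def)

lemma rise_uminus: "rise (\<lambda>i. - g i) n = fall g n"
  by (simp add: rise_def fall_def)

lemma play_step_le:
  assumes "0 \<le> r"
  shows "\<bar>play r x (Suc n) - play r x n\<bar> \<le> \<bar>x (Suc n) - x n\<bar>"
  using play_close[OF assms, of x n] by auto

lemma play_step_identity:
  fixes x :: "nat \<Rightarrow> real"
  assumes "0 \<le> r"
  defines "g \<equiv> play r x"
  shows "2 * r * \<bar>g (Suc n) - g n\<bar> =
    (x (Suc n) - x n)\<^sup>2 + 2 * (x n - g n) * (x (Suc n) - x n) - (g (Suc n) - g n)\<^sup>2
    - ((x (Suc n) - g (Suc n))\<^sup>2 - (x n - g n)\<^sup>2)"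
proof -
  \<comment> \<open>\<open>g\<close> moves up only when pushed by the lower edge and down only when pushed by the upper one\<close>
  have "r * \<bar>g (Suc n) - g n\<bar> = (x (Suc n) - g (Suc n)) * (g (Suc n) - g n)"
  proof -
    have "g (Suc n) = max (x (Suc n) - r) (min (x (Suc n) + r) (g n))" by (simp add: g_def)
    then consider "g (Suc n) = g n" | "g (Suc n) > g n" "x (Suc n) - g (Suc n) = r"
      | "g (Suc n) < g n" "x (Suc n) - g (Suc n) = - r"
      using assms(1) by linarith
    then show ?thesis by cases (simp_all add: right_diff_distrib)
  qed
  then show ?thesis by (simp add: power2_eq_square algebra_simps)
qed

text \<open>
  This is what ties the variation of \<open>g\<close> to quadratic variation. The right-hand side contains a
  transform of \<open>x\<close> whose coefficients \<open>x i - g i\<close> are bounded by \<open>r\<close> and depend only on the values of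
  \<open>x\<close> up to \<open>i\<close>; the other terms are squares.
\<close>

lemma play_identity:
  fixes x :: "nat \<Rightarrow> real"
  assumes "0 \<le> r"
  defines "g \<equiv> play r x"
  shows "2 * r * (rise g n + fall g n) =
    (\<Sum>i<n. (x (Suc i) - x i)\<^sup>2) + 2 * (\<Sum>i<n. (x i - g i) * (x (Suc i) - x i))
    - (\<Sum>i<n. (g (Suc i) - g i)\<^sup>2) - (x n - g n)\<^sup>2"
proof (induction n)
  case 0
  then show ?case by (simp add: rise_def fall_def g_def)
next
  case (Suc n)
  have "rise g (Suc n) + fall g (Suc n) = rise g n + fall g n + \<bar>g (Suc n) - g n\<bar>"
    by (simp add: rise_plus_fall)
  then have "2 * r * (rise g (Suc n) + fall g (Suc n)) =
      2 * r * (rise g n + fall g n) + 2 * r * \<bar>g (Suc n) - g n\<bar>"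
    by (simp only: distrib_left)
  then show ?case
    unfolding Suc.IH using play_step_identity[OF assms(1), of x n, folded g_def]
    by (simp add: algebra_simps)
qed

text \<open>
  As \<open>g\<close> stays within \<open>r\<close> of \<open>x\<close>, it must rise by at least the excess over \<open>2 * r\<close> of any rise of \<open>x\<close>.
  Consecutive index intervals may share an end point, because the grid points to which this is
  applied arise from rounding.
\<close>

lemma sum_trunc_le_rise:
  assumes "0 \<le> r" and ab: "\<And>i. i \<in> {1..k} \<Longrightarrow> a i \<le> b i" "\<And>i. i \<in> {1..<k} \<Longrightarrow> b i \<le> a (Suc i)"
    and bn: "\<And>i. i \<in> {1..k} \<Longrightarrow> b i \<le> n"
  shows "(\<Sum>i = 1..k. trunc (2 * r) (x (b i) - x (a i))) \<le> rise (play r x) n"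
proof -
  define g where "g = play r x"
  have seg: "rise g a + trunc (2 * r) (x b - x a) \<le> rise g b" if "a \<le> b" for a b
  proof -
    have "rise g b = rise g a + (\<Sum>i\<in>{a..<b}. max 0 (g (Suc i) - g i))"
      unfolding rise_def using that
      by (metis atLeast0LessThan le0 sum.atLeastLessThan_concat)
    moreover have "(\<Sum>i\<in>{a..<b}. g (Suc i) - g i) \<le> (\<Sum>i\<in>{a..<b}. max 0 (g (Suc i) - g i))"
      by (rule sum_mono) auto
    moreover have "(\<Sum>i\<in>{a..<b}. g (Suc i) - g i) = g b - g a"
      using that by (rule sum_Suc_diff')
    moreover have "0 \<le> (\<Sum>i\<in>{a..<b}. max 0 (g (Suc i) - g i))"
      by (rule sum_nonneg) auto
    moreover have "\<bar>x a - g a\<bar> \<le> r" "\<bar>x b - g b\<bar> \<le> r"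
      using play_close[OF assms(1)] by (simp_all add: g_def)
    ultimately show ?thesis by (auto simp: trunc_def)
  qed
  have mono: "rise g i \<le> rise g j" if "i \<le> j" for i j
    unfolding rise_def using that by (intro sum_mono2) auto
  have "j \<ge> 1 \<longrightarrow> (\<Sum>i = 1..j. trunc (2 * r) (x (b i) - x (a i))) \<le> rise g (b j)" if "j \<le> k" for j
    using that
  proof (induction j)
    case (Suc j)
    have s: "rise g (a (Suc j)) + trunc (2 * r) (x (b (Suc j)) - x (a (Suc j))) \<le> rise g (b (Suc j))"
      using Suc.prems by (intro seg ab) auto
    show ?case
    proof (cases "j = 0")
      case True
      then show ?thesis using s rise_nonneg[of g "a (Suc j)"] by simp
    next
      case False
      then have "b j \<le> a (Suc j)" using Suc.prems by (intro ab) auto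
      then have "rise g (b j) \<le> rise g (a (Suc j))" by (rule mono)
      then show ?thesis using Suc False s by simp
    qed
  qed simp
  from this[of k] have *: "k \<ge> 1 \<Longrightarrow> (\<Sum>i = 1..k. trunc (2 * r) (x (b i) - x (a i))) \<le> rise g (b k)"
    by simp
  show ?thesis
  proof (cases "k = 0")
    case True
    then show ?thesis by (simp add: rise_nonneg)
  next
    case False
    then have "rise g (b k) \<le> rise g n" by (intro mono bn) auto
    then show ?thesis using False * by (simp add: g_def)
  qed
qed

text \<open>
  Here \<open>W i\<close> stands for a truncated variation up to index \<open>i\<close>, and the weights select which one:
  both are \<open>1\<close> for the total, one of them is \<open>0\<close> for the upward and the downward variation. Between
  two falls, \<open>g\<close> rises from a point where \<open>x = g - r\<close> to one where \<open>x = g + r\<close>. Its rise is that of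
  \<open>x\<close> less \<open>2 * r\<close>, which is what \<open>W\<close> gains. The same holds for a fall between two rises. Only the
  first run and the one in progress need not be of this form, and each costs a multiple of \<open>r\<close>.
\<close>

lemma weighted_play_variation_le:
  fixes W x :: "nat \<Rightarrow> real"
  assumes "0 \<le> r" "0 \<le> \<alpha>" "0 \<le> \<beta>" "0 \<le> W 0"
    and W: "\<And>i j. i \<le> j \<Longrightarrow> j \<le> n \<Longrightarrow>
      W i + \<alpha> * trunc (2 * r) (x j - x i) + \<beta> * trunc (2 * r) (x i - x j) \<le> W j"
  shows "\<alpha> * rise (play r x) n + \<beta> * fall (play r x) n \<le> W n + (3 * \<alpha> + \<beta>) * r"
proof -
  define g where "g = play r x"
  define L where "L k = \<alpha> * rise g k + \<beta> * fall g k" for k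
  have up: "W i + \<alpha> * (x j - x i - 2 * r) \<le> W j" if "i \<le> j" "j \<le> n" for i j
  proof -
    have "\<alpha> * (x j - x i - 2 * r) \<le> \<alpha> * trunc (2 * r) (x j - x i)" "0 \<le> \<beta> * trunc (2 * r) (x i - x j)"
      using assms by (auto simp: trunc_def intro!: mult_left_mono)
    then show ?thesis using W[OF that] by linarith
  qed
  have dn: "W i + \<beta> * (x i - x j - 2 * r) \<le> W j" if "i \<le> j" "j \<le> n" for i j
  proof -
    have "\<beta> * (x i - x j - 2 * r) \<le> \<beta> * trunc (2 * r) (x i - x j)" "0 \<le> \<alpha> * trunc (2 * r) (x j - x i)"
      using assms by (auto simp: trunc_def intro!: mult_left_mono)
    then show ?thesis using W[OF that] by linarith
  qed
  \<comment> \<open>\<open>x a\<close> is the value from which the run in progress is measured if it is a rise, \<open>x b\<close> if it is a fall\<close>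
  have "(\<exists>a\<le>k. L k \<le> W a + \<alpha> * (g k - x a) + \<beta> * r) \<and>
        (\<exists>b\<le>k. L k \<le> W b + \<beta> * (x b - g k) + \<alpha> * r)" if "k \<le> n" for k
    using that
  proof (induction k)
    case 0
    then show ?case using assms by (auto simp: L_def rise_def fall_def g_def)
  next
    case (Suc k)
    then obtain a b where a: "a \<le> k" "L k \<le> W a + \<alpha> * (g k - x a) + \<beta> * r"
      and b: "b \<le> k" "L k \<le> W b + \<beta> * (x b - g k) + \<alpha> * r" by auto
    have L: "L (Suc k) = L k + \<alpha> * max 0 (g (Suc k) - g k) + \<beta> * max 0 (g k - g (Suc k))"
      by (simp add: L_def rise_def fall_def algebra_simps)
    consider "g (Suc k) = g k" | "g (Suc k) > g k" "g (Suc k) = x (Suc k) - r"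
      | "g (Suc k) < g k" "g (Suc k) = x (Suc k) + r"
    proof -
      have "g (Suc k) = max (x (Suc k) - r) (min (x (Suc k) + r) (g k))" by (simp add: g_def)
      then show ?thesis using that assms(1) by linarith
    qed
    then show ?case
    proof cases
      case 1
      then show ?thesis using a b L by (auto intro: le_SucI)
    next
      case 2
      then have L': "L (Suc k) \<le> W a + \<alpha> * (g (Suc k) - x a) + \<beta> * r"
        using a L by (simp add: algebra_simps)
      have eq: "x (Suc k) = g (Suc k) + r" using 2 by simp
      have "W a + \<alpha> * (x (Suc k) - x a - 2 * r) \<le> W (Suc k)"
        using a Suc.prems by (intro up) auto
      then have "L (Suc k) \<le> W (Suc k) + \<beta> * (x (Suc k) - g (Suc k)) + \<alpha> * r"
        using L' \<open>W _ + _ \<le> W (Suc k)\<close> unfolding eq by (simp add: algebra_simps)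
      then show ?thesis using L' a by (meson le_SucI order_refl)
    next
      case 3
      then have L': "L (Suc k) \<le> W b + \<beta> * (x b - g (Suc k)) + \<alpha> * r"
        using b L by (simp add: algebra_simps)
      have eq: "x (Suc k) = g (Suc k) - r" using 3 by simp
      have "W b + \<beta> * (x b - x (Suc k) - 2 * r) \<le> W (Suc k)"
        using b Suc.prems by (intro dn) auto
      then have "L (Suc k) \<le> W (Suc k) + \<alpha> * (g (Suc k) - x (Suc k)) + \<beta> * r"
        using L' \<open>W _ + _ \<le> W (Suc k)\<close> unfolding eq by (simp add: algebra_simps)
      then show ?thesis using L' b by (meson le_SucI order_refl)
    qed
  qed
  then obtain a where a: "a \<le> n" "L n \<le> W a + \<alpha> * (g n - x a) + \<beta> * r" by blast
  have "g n \<le> x n + r" using play_close[OF assms(1), of x n] by (simp add: g_def)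
  then have "\<alpha> * g n \<le> \<alpha> * (x n + r)" using assms by (intro mult_left_mono)
  then show ?thesis using a up[of a n] by (simp add: L_def g_def algebra_simps)
qed

section \<open>Truncated variation\<close>

abbreviation (input) UTV :: "real \<Rightarrow> (real \<Rightarrow> real) \<Rightarrow> real \<Rightarrow> real \<Rightarrow> real"
  where "UTV c f a b \<equiv> enn2real (up_truncated_variation c f a b)"

abbreviation (input) DTV :: "real \<Rightarrow> (real \<Rightarrow> real) \<Rightarrow> real \<Rightarrow> real \<Rightarrow> real"
  where "DTV c f a b \<equiv> enn2real (down_truncated_variation c f a b)"

abbreviation (input) TV :: "real \<Rightarrow> (real \<Rightarrow> real) \<Rightarrow> real \<Rightarrow> real \<Rightarrow> real"
  where "TV c f a b \<equiv> enn2real (truncated_variation c f a b)"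

lemma trunc_nonneg: "0 \<le> trunc c x"
  by (simp add: trunc_def)

lemma DTV_eq_UTV: "DTV c f a b = UTV c (\<lambda>x. - f x) a b"
  by (simp add: down_truncated_variation_def up_truncated_variation_def)

lemma sum_le_UTV:
  assumes "0 < c" "continuous_on {a..b} f" "(n, t, s) \<in> alternating_points a b"
  shows "(\<Sum>i = 1..n. trunc c (f (s i) - f (t i))) \<le> UTV c f a b"
proof -
  have "ennreal (\<Sum>i = 1..n. trunc c (f (s i) - f (t i))) \<le> up_truncated_variation c f a b"
    unfolding up_truncated_variation_def using assms(3) by (rule SUP_upper2) simp
  then have "enn2real (ennreal (\<Sum>i = 1..n. trunc c (f (s i) - f (t i)))) \<le> UTV c f a b"
    using up_truncated_variation_finite[OF assms(1,2)] by (intro enn2real_mono) auto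
  then show ?thesis by (simp add: sum_nonneg trunc_nonneg)
qed

lemma UTV_least:
  assumes "\<And>n t s. (n, t, s) \<in> alternating_points a b \<Longrightarrow>
    (\<Sum>i = 1..n. trunc c (f (s i) - f (t i))) \<le> K"
  shows "UTV c f a b \<le> K"
proof (rule enn2real_leI)
  show "0 \<le> K" using assms[of 0] by (simp add: alternating_points_def)
  show "up_truncated_variation c f a b \<le> ennreal K"
    unfolding up_truncated_variation_def
    by (rule SUP_least, clarify, rule ennreal_leI, rule assms)
qed

lemma sum_le_TV:
  assumes "0 < c" "continuous_on {a..b} f" "(n, t) \<in> increasing_points a b"
  shows "(\<Sum>i = 1..<n. trunc c \<bar>f (t (Suc i)) - f (t i)\<bar>) \<le> TV c f a b"
proof -
  have "ennreal (\<Sum>i = 1..<n. trunc c \<bar>f (t (Suc i)) - f (t i)\<bar>) \<le> truncated_variation c f a b"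
    unfolding truncated_variation_def using assms(3) by (rule SUP_upper2) simp
  then have "enn2real (ennreal (\<Sum>i = 1..<n. trunc c \<bar>f (t (Suc i)) - f (t i)\<bar>)) \<le> TV c f a b"
    using truncated_variation_finite[OF assms(1,2)] by (intro enn2real_mono) auto
  then show ?thesis by (simp add: sum_nonneg trunc_nonneg)
qed

lemma TV_least:
  assumes "\<And>n t. (n, t) \<in> increasing_points a b \<Longrightarrow>
    (\<Sum>i = 1..<n. trunc c \<bar>f (t (Suc i)) - f (t i)\<bar>) \<le> K"
  shows "TV c f a b \<le> K"
proof (rule enn2real_leI)
  show "0 \<le> K" using assms[of 0] by (simp add: increasing_points_def)
  show "truncated_variation c f a b \<le> ennreal K"
    unfolding truncated_variation_def
    by (rule SUP_least, clarify, rule ennreal_leI, rule assms)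
qed

lemma UTV_antimono:
  assumes "0 < c" "c \<le> d" "continuous_on {a..b} f"
  shows "UTV d f a b \<le> UTV c f a b"
proof (rule UTV_least)
  fix n t s assume "(n, t, s) \<in> alternating_points a b"
  then show "(\<Sum>i = 1..n. trunc d (f (s i) - f (t i))) \<le> UTV c f a b"
    using assms by (intro order_trans[OF sum_mono sum_le_UTV]) (auto simp: trunc_def)
qed

lemma TV_antimono:
  assumes "0 < c" "c \<le> d" "continuous_on {a..b} f"
  shows "TV d f a b \<le> TV c f a b"
proof (rule TV_least)
  fix n t assume "(n, t) \<in> increasing_points a b"
  then show "(\<Sum>i = 1..<n. trunc d \<bar>f (t (Suc i)) - f (t i)\<bar>) \<le> TV c f a b"
    using assms by (intro order_trans[OF sum_mono sum_le_TV]) (auto simp: trunc_def)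
qed

lemma alternating_pointsD:
  assumes "(n, t, s) \<in> alternating_points a b"
  shows "1 \<le> i \<Longrightarrow> i \<le> n \<Longrightarrow> a \<le> t i" and "1 \<le> i \<Longrightarrow> i \<le> n \<Longrightarrow> t i < s i"
    and "1 \<le> i \<Longrightarrow> i \<le> n \<Longrightarrow> s i \<le> b" and "1 \<le> i \<Longrightarrow> i < n \<Longrightarrow> s i < t (Suc i)"
  using assms by (auto simp: alternating_points_def image_subset_iff)

lemma alternating_pointsI:
  assumes "\<And>i. 1 \<le> i \<Longrightarrow> i \<le> n \<Longrightarrow> a \<le> t i" "\<And>i. 1 \<le> i \<Longrightarrow> i \<le> n \<Longrightarrow> t i < s i"
    "\<And>i. 1 \<le> i \<Longrightarrow> i \<le> n \<Longrightarrow> s i \<le> b" "\<And>i. 1 \<le> i \<Longrightarrow> i < n \<Longrightarrow> s i < t (Suc i)"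
  shows "(n, t, s) \<in> alternating_points a b"
proof -
  have "a \<le> t i \<and> t i \<le> b \<and> a \<le> s i \<and> s i \<le> b" if "1 \<le> i" "i \<le> n" for i
    using assms(1-3)[OF that] by linarith
  then show ?thesis
    using assms(2,4) by (simp add: alternating_points_def image_subset_iff)
qed

lemma alternating_points_append:
  assumes A: "(n, t, s) \<in> alternating_points a b" and v: "n \<noteq> 0 \<Longrightarrow> s n < v" "a \<le> v" "v < w" "w \<le> b'"
    and "b \<le> b'"
  shows "(Suc n, t(Suc n := v), s(Suc n := w)) \<in> alternating_points a b'"
proof (rule alternating_pointsI)
  fix i :: nat assume i: "1 \<le> i" "i \<le> Suc n"
  show "a \<le> (t(Suc n := v)) i" "(t(Suc n := v)) i < (s(Suc n := w)) i"
    "(s(Suc n := w)) i \<le> b'"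
    using alternating_pointsD(1-3)[OF A, of i] i v \<open>b \<le> b'\<close> by (cases "i = Suc n"; simp)+
next
  fix i :: nat assume i: "1 \<le> i" "i < Suc n"
  then show "(s(Suc n := w)) i < (t(Suc n := v)) (Suc i)"
    using alternating_pointsD(4)[OF A, of i] v(1) by (cases "i = n") auto
qed

lemma alternating_points_shift_last:
  assumes A: "(n, t, s) \<in> alternating_points a b" and v: "0 < n" "t n \<le> v" "v < w" "w \<le> b'"
    and "b \<le> b'"
  shows "(n, t(n := v), s(n := w)) \<in> alternating_points a b'"
proof (rule alternating_pointsI)
  fix i :: nat assume i: "1 \<le> i" "i \<le> n"
  show "a \<le> (t(n := v)) i" "(t(n := v)) i < (s(n := w)) i" "(s(n := w)) i \<le> b'"
    using alternating_pointsD(1-3)[OF A, of i] i v \<open>b \<le> b'\<close> by (cases "i = n"; simp)+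
next
  fix i :: nat assume i: "1 \<le> i" "i < n"
  then show "(s(n := w)) i < (t(n := v)) (Suc i)"
    using alternating_pointsD(4)[OF A, of i] v(2) by (cases "Suc i = n") auto
qed

text \<open>
  The interval \<open>[b, b']\<close> cannot simply be added to a family of intervals in \<open>[a, b]\<close>, since the last
  one may end at \<open>b\<close> and the intervals have to be disjoint. In this case it is prolonged, which
  loses nothing, as \<open>trunc c\<close> is superadditive on nonnegative arguments, unless the last interval
  contributed nothing and can be given up.
\<close>

lemma UTV_superadditive:
  assumes c: "0 < c" and f: "continuous_on {a..b'} f" and ab: "a \<le> b" "b \<le> b'"
  shows "UTV c f a b + trunc c (f b' - f b) \<le> UTV c f a b'"
proof -
  have "UTV c f a b \<le> UTV c f a b' - trunc c (f b' - f b)"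
  proof (rule UTV_least)
    fix n t s assume A: "(n, t, s) \<in> alternating_points a b"
    let ?S = "\<lambda>n t s. \<Sum>i = 1..n. trunc c (f (s i) - f (t i))"
    consider (zero) "trunc c (f b' - f b) = 0"
      | (new) "b < b'" "n = 0 \<or> s n < b" | (join) "b < b'" "0 < n" "s n = b" "0 < trunc c (f b' - f b)"
    proof -
      have "trunc c (f b' - f b) = 0" if "b = b'" using that c by (simp add: trunc_def)
      moreover have "s n \<le> b" if "n \<noteq> 0"
        using A that by (auto simp: alternating_points_def image_subset_iff)
      ultimately show ?thesis using ab that trunc_nonneg[of c "f b' - f b"] by linarith
    qed
    then have "?S n t s + trunc c (f b' - f b) \<le> UTV c f a b'"
    proof cases
      case zero
      have "(n, t, s) \<in> alternating_points a b'"
        using A ab by (auto simp: alternating_points_def image_subset_iff)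
      then show ?thesis using sum_le_UTV[OF c f] zero by simp
    next
      case new
      have "(Suc n, t(Suc n := b), s(Suc n := b')) \<in> alternating_points a b'"
        using new ab by (intro alternating_points_append[OF A]) auto
      moreover have "?S (Suc n) (t(Suc n := b)) (s(Suc n := b')) = ?S n t s + trunc c (f b' - f b)"
        by simp
      ultimately show ?thesis using sum_le_UTV[OF c f] by metis
    next
      case join
      then obtain m where m: "n = Suc m" by (cases n) auto
      have tn: "t n < b"
        using alternating_pointsD(2)[OF A, of n] join by simp
      have shift: "?S n (t(n := v)) (s(n := b')) \<le> UTV c f a b'" if "t n \<le> v" "v < b'" for v
        using that join ab by (intro sum_le_UTV[OF c f] alternating_points_shift_last[OF A]) auto
      have S: "?S n (t(n := v)) (s(n := b')) = ?S m t s + trunc c (f b' - f v)" for v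
        by (simp add: m)
      have "?S n t s = ?S m t s + trunc c (f b - f (t n))" using join by (simp add: m)
      \<comment> \<open>the last interval ends at \<open>b\<close>: prolong it to \<open>b'\<close>, or give it up for \<open>[b, b']\<close>\<close>
      then show ?thesis
        using shift[of "t n"] shift[of b] tn join c unfolding S by (auto simp: trunc_def max_def)
    qed
    then show "?S n t s \<le> UTV c f a b' - trunc c (f b' - f b)" by simp
  qed
  then show ?thesis by simp
qed

lemma DTV_superadditive:
  assumes "0 < c" "continuous_on {a..b'} f" "a \<le> b" "b \<le> b'"
  shows "DTV c f a b + trunc c (f b - f b') \<le> DTV c f a b'"
  using UTV_superadditive[of c a b' "\<lambda>x. - f x" b] assms
  by (simp add: DTV_eq_UTV continuous_on_minus)

lemma increasing_points_append:
  assumes A: "(n, t) \<in> increasing_points a b" and v: "n \<noteq> 0 \<Longrightarrow> t n < v" "a \<le> v" "v \<le> b'" and "b \<le> b'"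
  shows "(Suc n, t(Suc n := v)) \<in> increasing_points a b'"
proof -
  have less: "t i < t j" if "1 \<le> i" "i < j" "j \<le> n" for i j
    using A that by (auto simp: increasing_points_def strict_mono_on_def)
  have mem: "a \<le> t i" "t i \<le> b" if "1 \<le> i" "i \<le> n" for i
    using A that by (auto simp: increasing_points_def image_subset_iff)
  have last: "t i < v" if "1 \<le> i" "i \<le> n" for i
    using less[of i n] v(1) that by (cases "i = n") auto
  have "strict_mono_on {1..Suc n} (t(Suc n := v))"
    using less last by (intro strict_mono_onI) (auto simp: le_Suc_eq)
  moreover have "(t(Suc n := v)) i \<in> {a..b'}" if "i \<in> {1..Suc n}" for i
    using mem[of i] that v(2,3) \<open>b \<le> b'\<close> by (cases "i = Suc n") auto
  ultimately show ?thesis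
    unfolding increasing_points_def by blast
qed

lemma TV_superadditive:
  assumes c: "0 < c" and f: "continuous_on {a..b'} f" and ab: "a \<le> b" "b \<le> b'"
  shows "TV c f a b + trunc c \<bar>f b' - f b\<bar> \<le> TV c f a b'"
proof -
  have "TV c f a b \<le> TV c f a b' - trunc c \<bar>f b' - f b\<bar>"
  proof (rule TV_least)
    fix n t assume A: "(n, t) \<in> increasing_points a b"
    let ?S = "\<lambda>n t. \<Sum>i = 1..<n. trunc c \<bar>f (t (Suc i)) - f (t i)\<bar>"
    have tn: "t n \<le> b" if "n \<noteq> 0"
      using A that by (auto simp: increasing_points_def image_subset_iff)
    consider (zero) "b = b'" | (new) "b < b'" "n = 0 \<or> t n < b" | (join) "b < b'" "0 < n" "t n = b"
      using ab tn by linarith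
    then have "?S n t + trunc c \<bar>f b' - f b\<bar> \<le> TV c f a b'"
    proof cases
      case zero
      then show ?thesis using sum_le_TV[OF c f] A c by (simp add: trunc_def)
    next
      case new
      let ?t = "t(Suc n := b, Suc (Suc n) := b')"
      have "(Suc n, t(Suc n := b)) \<in> increasing_points a b"
        using new ab by (intro increasing_points_append[OF A]) auto
      then have "(Suc (Suc n), ?t) \<in> increasing_points a b'"
        by (rule increasing_points_append) (use new ab in auto)
      moreover have "?S n t + trunc c \<bar>f b' - f b\<bar> \<le> ?S (Suc (Suc n)) ?t"
        by (cases "n = 0") (simp_all add: trunc_nonneg)
      ultimately show ?thesis using sum_le_TV[OF c f] by (meson order_trans)
    next
      case join
      let ?t = "t(Suc n := b')"
      have "(Suc n, ?t) \<in> increasing_points a b'"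
        using join ab by (intro increasing_points_append[OF A]) auto
      moreover have "?S (Suc n) ?t = ?S n t + trunc c \<bar>f b' - f b\<bar>"
        using join by simp
      ultimately show ?thesis using sum_le_TV[OF c f] by metis
    qed
    then show "?S n t \<le> TV c f a b' - trunc c \<bar>f b' - f b\<bar>" by simp
  qed
  then show ?thesis by simp
qed

lemma UTV_mono:
  assumes "0 < c" "continuous_on {a..b'} f" "a \<le> b" "b \<le> b'"
  shows "UTV c f a b \<le> UTV c f a b'"
  using UTV_superadditive[OF assms] trunc_nonneg[of c "f b' - f b"] by linarith

lemma TV_mono:
  assumes "0 < c" "continuous_on {a..b'} f" "a \<le> b" "b \<le> b'"
  shows "TV c f a b \<le> TV c f a b'"
  using TV_superadditive[OF assms] trunc_nonneg[of c "\<bar>f b' - f b\<bar>"] by linarith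

text \<open>
  Every increment counts either upward or downward; superadditivity of the two one-sided variations
  collects the increments of an increasing sequence one at a time.
\<close>

lemma TV_le_UTV_plus_DTV:
  assumes c: "0 < c" and f: "continuous_on {a..b} f"
  shows "TV c f a b \<le> UTV c f a b + DTV c f a b"
proof (rule TV_least)
  fix n t assume A: "(n, t) \<in> increasing_points a b"
  let ?S = "\<lambda>n. \<Sum>i = 1..<n. trunc c \<bar>f (t (Suc i)) - f (t i)\<bar>"
  have mem: "t i \<in> {a..b}" if "i \<in> {1..n}" for i
    using A that by (auto simp: increasing_points_def image_subset_iff)
  have "1 \<le> k \<longrightarrow> ?S k \<le> UTV c f a (t k) + DTV c f a (t k)" if "k \<le> n" for k
    using that
  proof (induction k)
    case (Suc k)
    show ?case
    proof (cases "k = 0")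
      case False
      then have k: "k \<in> {1..n}" "Suc k \<in> {1..n}" using Suc.prems by auto
      have "t k \<le> t (Suc k)" using A k by (auto simp: increasing_points_def strict_mono_on_leD)
      moreover have "continuous_on {a..t (Suc k)} f"
        using f mem[OF k(2)] by (auto intro: continuous_on_subset)
      moreover have "trunc c \<bar>f (t (Suc k)) - f (t k)\<bar> =
          trunc c (f (t (Suc k)) - f (t k)) + trunc c (f (t k) - f (t (Suc k)))"
        using c by (auto simp: trunc_def)
      ultimately show ?thesis
        using UTV_superadditive[OF c, of a "t (Suc k)" f "t k"]
          DTV_superadditive[OF c, of a "t (Suc k)" f "t k"] mem[OF k(1)] Suc False by simp
    qed simp
  qed simp
  then have n: "1 \<le> n \<Longrightarrow> ?S n \<le> UTV c f a (t n) + DTV c f a (t n)" by simp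
  show "?S n \<le> UTV c f a b + DTV c f a b"
  proof (cases "1 \<le> n")
    case True
    have "UTV c f a (t n) \<le> UTV c f a b" "DTV c f a (t n) \<le> DTV c f a b"
      unfolding DTV_eq_UTV using mem[of n] True c f
      by (auto intro!: UTV_mono continuous_on_minus)
    then show ?thesis using n True by linarith
  qed simp
qed

section \<open>Truncated variation along uniform grids\<close>

definition grid :: "real \<Rightarrow> nat \<Rightarrow> nat \<Rightarrow> real"
  where "grid t N i = t * real i / real N"

lemma grid_mono: "0 \<le> t \<Longrightarrow> i \<le> j \<Longrightarrow> grid t N i \<le> grid t N j"
  by (simp add: grid_def divide_right_mono mult_left_mono)

lemma grid_0 [simp]: "grid t N 0 = 0"
  by (simp add: grid_def)

lemma grid_last [simp]: "0 < N \<Longrightarrow> grid t N N = t"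
  by (simp add: grid_def)

lemma grid_mem: "0 \<le> t \<Longrightarrow> i \<le> N \<Longrightarrow> grid t N i \<in> {0..t}"
  by (cases "N = 0") (auto simp: grid_def field_simps mult_left_mono)

lemma grid_step: "grid t N (Suc i) - grid t N i = t / real N"
  by (simp add: grid_def distrib_left add_divide_distrib)

text \<open>
  A nearly optimal family of intervals is rounded to the grid. By continuity this changes its sum
  only slightly once the grid is fine, and for the rounded family the rise of the play operator
  is an upper bound.
\<close>

lemma UTV_le_rise:
  assumes c: "0 < c" and t: "0 \<le> t" and f: "continuous_on {0..t} f" and \<delta>: "0 < \<delta>"
  shows "\<forall>\<^sub>F N in sequentially. UTV c f 0 t \<le> rise (play (c / 2) (\<lambda>i. f (grid t N i))) N + \<delta>"
proof -
  obtain n u s where A: "(n, u, s) \<in> alternating_points 0 t"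
    and S: "UTV c f 0 t - \<delta> / 2 < (\<Sum>i = 1..n. trunc c (f (s i) - f (u i)))"
    using UTV_least[of 0 t c f "UTV c f 0 t - \<delta> / 2"] \<delta> by (meson not_le diff_less_eq less_add_same_cancel1 half_gt_zero)
  have mem: "u i \<in> {0..t}" "s i \<in> {0..t}" "u i < s i" if "i \<in> {1..n}" for i
    using A that by (auto simp: alternating_points_def image_subset_iff)
  have next_le: "s i < u (Suc i)" if "i \<in> {1..<n}" for i
    using A that by (auto simp: alternating_points_def)
  \<comment> \<open>index of the last grid point not after \<open>v\<close>\<close>
  define \<rho> where "\<rho> N v = nat \<lfloor>v * real N / t\<rfloor>" for N v
  have \<rho>_mono: "\<rho> N v \<le> \<rho> N w" if "v \<le> w" for N v w
    unfolding \<rho>_def using that t by (intro nat_mono floor_mono divide_right_mono mult_right_mono) auto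
  have \<rho>_le: "\<rho> N v \<le> N" if "v \<in> {0..t}" for N v
  proof -
    have "v * real N / t \<le> real N"
      using that t by (cases "t = 0") (auto simp: field_simps mult_right_mono)
    then have "\<lfloor>v * real N / t\<rfloor> \<le> int N" by linarith
    then show ?thesis by (simp add: \<rho>_def)
  qed
  have lim: "(\<lambda>N. grid t N (\<rho> N v)) \<longlonglongrightarrow> v" if v: "v \<in> {0..t}" for v
  proof (cases "t = 0")
    case True
    then show ?thesis using v by (simp add: grid_def)
  next
    case False
    then have t0: "0 < t" using t by simp
    have "\<forall>\<^sub>F N in sequentially. \<bar>grid t N (\<rho> N v) - v\<bar> \<le> t / real N"
      using eventually_gt_at_top[of 0]
    proof eventually_elim
      case (elim N)
      have r: "real (\<rho> N v) = real_of_int \<lfloor>v * real N / t\<rfloor>" using v t0 by (simp add: \<rho>_def)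
      have "real (\<rho> N v) \<le> v * real N / t" "v * real N / t < real (\<rho> N v) + 1"
        unfolding r by linarith+
      then have "t * real (\<rho> N v) \<le> v * real N" "v * real N \<le> t * real (\<rho> N v) + t"
        using t0 by (simp_all add: field_simps)
      then have "grid t N (\<rho> N v) \<le> v" "v \<le> grid t N (\<rho> N v) + t / real N"
        using elim by (simp_all add: grid_def field_simps)
      then show ?case by linarith
    qed
    moreover have "(\<lambda>N. t / real N) \<longlonglongrightarrow> 0" by (rule lim_const_over_n)
    ultimately have "(\<lambda>N. grid t N (\<rho> N v) - v) \<longlonglongrightarrow> 0"
      by (rule tendsto_rabs_zero_cancel[OF tendsto_sandwich[of "\<lambda>_. 0", rotated, OF _ tendsto_const]]) auto
    then show ?thesis by (simp add: LIM_zero_iff)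
  qed
  have flim: "(\<lambda>N. f (grid t N (\<rho> N v))) \<longlonglongrightarrow> f v" if v: "v \<in> {0..t}" for v
    using v \<rho>_le[OF v] by (intro continuous_on_tendsto_compose[OF f lim[OF v]])
      (auto intro!: always_eventually grid_mem[OF t, unfolded atLeastAtMost_iff, THEN conjunct1]
        grid_mem[OF t, unfolded atLeastAtMost_iff, THEN conjunct2])
  have "(\<lambda>N. \<Sum>i = 1..n. trunc c (f (grid t N (\<rho> N (s i))) - f (grid t N (\<rho> N (u i)))))
      \<longlonglongrightarrow> (\<Sum>i = 1..n. trunc c (f (s i) - f (u i)))"
    unfolding trunc_def by (intro tendsto_intros flim mem)
  then have "\<forall>\<^sub>F N in sequentially. UTV c f 0 t - \<delta> <
      (\<Sum>i = 1..n. trunc c (f (grid t N (\<rho> N (s i))) - f (grid t N (\<rho> N (u i)))))"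
    using S \<delta> by (intro order_tendstoD) auto
  then show ?thesis
  proof eventually_elim
    case (elim N)
    have "(\<Sum>i = 1..n. trunc (2 * (c / 2)) (f (grid t N (\<rho> N (s i))) - f (grid t N (\<rho> N (u i)))))
        \<le> rise (play (c / 2) (\<lambda>i. f (grid t N i))) N"
      using c by (intro sum_trunc_le_rise[where x = "\<lambda>i. f (grid t N i)"] \<rho>_mono \<rho>_le mem less_imp_le next_le) auto
    then show ?case using elim by simp
  qed
qed

lemma DTV_le_fall:
  assumes c: "0 < c" and "0 \<le> t" and "continuous_on {0..t} f" and "0 < \<delta>"
  shows "\<forall>\<^sub>F N in sequentially. DTV c f 0 t \<le> fall (play (c / 2) (\<lambda>i. f (grid t N i))) N + \<delta>"
proof -
  have "play (c / 2) (\<lambda>i. - f (grid t N i)) = (\<lambda>i. - play (c / 2) (\<lambda>i. f (grid t N i)) i)" for N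
    using c play_uminus[of "c / 2" "\<lambda>i. f (grid t N i)"] by auto
  then show ?thesis
    using UTV_le_rise[OF c assms(2), of "\<lambda>x. - f x" \<delta>] assms(3,4)
    by (simp add: DTV_eq_UTV rise_uminus continuous_on_minus)
qed

text \<open>
  In contrast to the upper bounds on the truncated variations, these hold for every grid.
\<close>

lemma play_variation_le_truncated_variation:
  assumes c: "0 < c" and t: "0 \<le> t" and f: "continuous_on {0..t} f" and N: "0 < N"
  defines "g \<equiv> play (c / 2) (\<lambda>i. f (grid t N i))"
  shows "rise g N + fall g N \<le> TV c f 0 t + 2 * c"
    and "rise g N \<le> UTV c f 0 t + 2 * c"
    and "fall g N \<le> DTV c f 0 t + 2 * c"
proof -
  have sub: "continuous_on {0..grid t N j} f" if "j \<le> N" for j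
    using grid_mem[OF t that] f by (auto intro: continuous_on_subset)
  have *: "0 \<le> grid t N i \<and> grid t N i \<le> grid t N j" if "i \<le> j" for i j
    using grid_mono[OF t that] grid_mono[OF t, of 0 i] by simp
  have "trunc c d + trunc c (- d) = trunc c \<bar>d\<bar>" for d
    using c by (auto simp: trunc_def)
  from this[of "f x - f y" for x y] have split: "trunc c (f x - f y) + trunc c (f y - f x) = trunc c \<bar>f x - f y\<bar>" for x y
    by simp
  have "1 * rise g N + 1 * fall g N \<le> TV c f 0 (grid t N N) + (3 * 1 + 1) * (c / 2)"
    unfolding g_def using c TV_superadditive[OF c sub] * split
    by (intro weighted_play_variation_le) (auto simp: add.assoc)
  then show "rise g N + fall g N \<le> TV c f 0 t + 2 * c" using N by simp
  have "1 * rise g N + 0 * fall g N \<le> UTV c f 0 (grid t N N) + (3 * 1 + 0) * (c / 2)"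
    unfolding g_def using c UTV_superadditive[OF c sub] *
    by (intro weighted_play_variation_le) auto
  then show "rise g N \<le> UTV c f 0 t + 2 * c" using N c by simp
  have "0 * rise g N + 1 * fall g N \<le> DTV c f 0 (grid t N N) + (3 * 0 + 1) * (c / 2)"
    unfolding g_def using c DTV_superadditive[OF c sub] *
    by (intro weighted_play_variation_le) auto
  then show "fall g N \<le> DTV c f 0 t + 2 * c" using N c by simp
qed

text \<open>
  Any sufficiently fine grid determines the truncated variations up to a multiple of \<open>c\<close>. Hence it
  is enough that the product of \<open>c\<close> and the variation of the play operator is close to \<open>q\<close> on
  infinitely many grids. The one-sided variations follow because rise and fall differ by a bounded
  amount, which is where the bound \<open>R\<close> enters.
\<close>

lemma truncated_variations_near:
  assumes c: "0 < c" and t: "0 \<le> t" and f: "continuous_on {0..t} f"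
    and R: "\<And>s. s \<in> {0..t} \<Longrightarrow> \<bar>f s\<bar> \<le> R"
    and freq: "\<exists>\<^sub>F N in sequentially.
      \<bar>c * (rise (play (c / 2) (\<lambda>i. f (grid t N i))) N + fall (play (c / 2) (\<lambda>i. f (grid t N i))) N) - q\<bar> \<le> e"
  shows "\<bar>c * TV c f 0 t - q\<bar> \<le> e + c * R + 3 * c\<^sup>2"
    and "\<bar>c * UTV c f 0 t - q / 2\<bar> \<le> e + c * R + 3 * c\<^sup>2"
    and "\<bar>c * DTV c f 0 t - q / 2\<bar> \<le> e + c * R + 3 * c\<^sup>2"
proof -
  \<comment> \<open>after multiplication by \<open>c\<close>, an error of \<open>c\<close> in each variation only costs \<open>c\<^sup>2\<close>\<close>
  have "\<forall>\<^sub>F N in sequentially. 0 < N \<and>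
      UTV c f 0 t \<le> rise (play (c / 2) (\<lambda>i. f (grid t N i))) N + c \<and>
      DTV c f 0 t \<le> fall (play (c / 2) (\<lambda>i. f (grid t N i))) N + c"
    by (intro eventually_conj eventually_gt_at_top UTV_le_rise DTV_le_fall c t f)
  from frequently_ex[OF frequently_eventually_frequently[OF freq this]]
  obtain N where N: "0 < N" and
    q: "\<bar>c * (rise (play (c / 2) (\<lambda>i. f (grid t N i))) N + fall (play (c / 2) (\<lambda>i. f (grid t N i))) N) - q\<bar> \<le> e"
    and U: "UTV c f 0 t \<le> rise (play (c / 2) (\<lambda>i. f (grid t N i))) N + c"
    and D: "DTV c f 0 t \<le> fall (play (c / 2) (\<lambda>i. f (grid t N i))) N + c"
    by blast
  define g where "g = play (c / 2) (\<lambda>i. f (grid t N i))"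
  define r s where "r = rise g N" and "s = fall g N"
  note lower = play_variation_le_truncated_variation[OF c t f N, folded g_def, folded r_def s_def]
  note U = U[folded g_def, folded r_def] and D = D[folded g_def, folded s_def]
    and q = q[folded g_def, folded r_def s_def]
  have "\<bar>f (grid t N N) - g N\<bar> \<le> c / 2"
    unfolding g_def using play_close[of "c / 2" "\<lambda>i. f (grid t N i)" N] c by simp
  moreover have "g 0 = f 0" by (simp add: g_def)
  moreover have "\<bar>f t\<bar> \<le> R" "\<bar>f 0\<bar> \<le> R" using R t by simp_all
  ultimately have "\<bar>r - s\<bar> \<le> 2 * R + c / 2"
    using rise_minus_fall[of g N, folded r_def s_def] unfolding grid_last[OF N] by linarith
  then have "c * \<bar>r - s\<bar> \<le> c * (2 * R + c / 2)" using c by (intro mult_left_mono) auto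
  moreover have "c * \<bar>r - s\<bar> = \<bar>c * r - c * s\<bar>"
    using c by (simp add: abs_mult flip: right_diff_distrib)
  ultimately have rs: "\<bar>c * r - c * s\<bar> \<le> 2 * (c * R) + c\<^sup>2 / 2"
    by (simp add: power2_eq_square distrib_left)
  have q: "\<bar>c * r + c * s - q\<bar> \<le> e" using q by (simp add: distrib_left)
  have R0: "0 \<le> c * R" using R[of 0] t c by (intro mult_nonneg_nonneg) auto
  have scale: "c * a \<le> c * b + k * c\<^sup>2" if "a \<le> b + k * c" for a b k
    using mult_left_mono[OF that, of c] c by (simp add: power2_eq_square algebra_simps)
  have Tu: "TV c f 0 t \<le> r + s + 2 * c" using TV_le_UTV_plus_DTV[OF c f] U D by simp
  have c2: "0 \<le> c\<^sup>2" by simp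
  have "c * TV c f 0 t \<le> c * (r + s) + 2 * c\<^sup>2" "c * (r + s) \<le> c * TV c f 0 t + 2 * c\<^sup>2"
    using scale Tu lower by auto
  then show "\<bar>c * TV c f 0 t - q\<bar> \<le> e + c * R + 3 * c\<^sup>2"
    using q R0 c2 by (simp add: distrib_left)
  have "c * UTV c f 0 t \<le> c * r + 1 * c\<^sup>2" "c * r \<le> c * UTV c f 0 t + 2 * c\<^sup>2"
    using scale[of _ _ 1] scale[of _ _ 2] U lower by auto
  then show "\<bar>c * UTV c f 0 t - q / 2\<bar> \<le> e + c * R + 3 * c\<^sup>2"
    using q R0 c2 rs by (auto simp: abs_le_iff)
  have "c * DTV c f 0 t \<le> c * s + 1 * c\<^sup>2" "c * s \<le> c * DTV c f 0 t + 2 * c\<^sup>2"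
    using scale[of _ _ 1] scale[of _ _ 2] D lower by auto
  then show "\<bar>c * DTV c f 0 t - q / 2\<bar> \<le> e + c * R + 3 * c\<^sup>2"
    using q R0 c2 rs by (auto simp: abs_le_iff)
qed

section \<open>Martingale transforms\<close>

definition clip :: "real \<Rightarrow> real \<Rightarrow> real"
  where "clip m v = max (- m) (min m v)"

text \<open>
  The state consists of the transform so far and of a flag that is lowered for good as soon as
  \<open>\<bar>y\<bar>\<close> exceeds \<open>m\<close> or the transform exceeds \<open>\<epsilon>\<close>; from then on the transform is frozen. The increment
  that leaves \<open>[- m, m]\<close> is cut off at the boundary, so that all increments used are bounded although
  \<open>y\<close> is not.
\<close>

primrec stopped_transform ::
    "real \<Rightarrow> real \<Rightarrow> (nat \<Rightarrow> real) \<Rightarrow> (nat \<Rightarrow> real) \<Rightarrow> nat \<Rightarrow> real \<times> bool"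
  where
    "stopped_transform m \<epsilon> h y 0 = (0, \<bar>y 0\<bar> \<le> m)"
  | "stopped_transform m \<epsilon> h y (Suc j) =
      (let (S, K) = stopped_transform m \<epsilon> h y j;
           S' = (if K then S + h j * (clip m (y (Suc j)) - y j) else S)
       in (S', K \<and> \<bar>y (Suc j)\<bar> \<le> m \<and> \<bar>S'\<bar> \<le> \<epsilon>))"

lemma stopped_transform_alive_bounds:
  assumes "0 \<le> \<epsilon>" "snd (stopped_transform m \<epsilon> h y j)"
  shows "\<bar>fst (stopped_transform m \<epsilon> h y j)\<bar> \<le> \<epsilon>" "\<bar>y j\<bar> \<le> m"
  using assms by (cases j; auto simp: Let_def split_beta)+

lemma stopped_transform_large:
  assumes "0 \<le> \<epsilon>" and y: "\<forall>i\<le>n. \<bar>y i\<bar> \<le> m"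
    and large: "\<epsilon> < \<bar>\<Sum>i<n. h i * (y (Suc i) - y i)\<bar>"
  shows "\<epsilon> < \<bar>fst (stopped_transform m \<epsilon> h y n)\<bar>"
proof -
  let ?st = "stopped_transform m \<epsilon> h y"
  have "(snd (?st j) \<and> fst (?st j) = (\<Sum>i<j. h i * (y (Suc i) - y i))) \<or>
      (\<not> snd (?st j) \<and> \<epsilon> < \<bar>fst (?st j)\<bar>)" if "j \<le> n" for j
    using that
  proof (induction j)
    case 0
    then show ?case using y by simp
  next
    case (Suc j)
    have "clip m (y (Suc j)) = y (Suc j)" using y Suc.prems by (auto simp: clip_def)
    then show ?case using Suc y by (auto simp: Let_def split_beta)
  qed
  from this[of n] show ?thesis using large by auto
qed

text \<open>
  For a martingale \<open>y\<close> both sums on the right have mean zero, so this bounds the second moment of the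
  stopped transform by the first moment of \<open>y n\<close>. The square grows by cross terms, which are linear in
  the increments, and by squared increments, which telescope up to further linear terms. Since the
  increment at which \<open>y\<close> leaves \<open>[- m, m]\<close> is cut off, it is centred only up to an error of at most
  \<open>\<bar>y (Suc j)\<bar>\<close>. This error occurs at a single index, and there \<open>y (Suc j)\<close> may be replaced by the
  terminal value \<open>y n\<close> at the expense of another centred term.
\<close>

lemma stopped_transform_square_le:
  fixes h y :: "nat \<Rightarrow> real"
  assumes "0 \<le> \<epsilon>" "0 \<le> m" and h: "\<And>i. \<bar>h i\<bar> \<le> c"
  defines "S \<equiv> \<lambda>j. fst (stopped_transform m \<epsilon> h y j)"
    and "K \<equiv> \<lambda>j. of_bool (snd (stopped_transform m \<epsilon> h y j)) :: real"
    and "B \<equiv> 2 * c * \<epsilon> + 2 * c\<^sup>2 * m"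
  shows "(S n)\<^sup>2 \<le> c\<^sup>2 * m\<^sup>2 + B * \<bar>y n\<bar>
      + (\<Sum>j<n. K j * (2 * S j * h j - 2 * c\<^sup>2 * y j) * (y (Suc j) - y j))
      - B * (\<Sum>j<n. (K j - K (Suc j)) * sgn (y (Suc j)) * (y n - y (Suc j)))"
proof -
  \<comment> \<open>\<open>(y j)\<^sup>2\<close> until the run is stopped, and afterwards the largest value that it can have had before\<close>
  define \<Psi> where "\<Psi> j = K j * (y j)\<^sup>2 + (1 - K j) * m\<^sup>2" for j
  have c: "0 \<le> c" using h[of 0] by linarith
  have B: "0 \<le> B" using assms c by (simp add: B_def)
  have step: "(S (Suc j))\<^sup>2 - (S j)\<^sup>2 \<le> c\<^sup>2 * (\<Psi> (Suc j) - \<Psi> j)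
      + K j * (2 * S j * h j - 2 * c\<^sup>2 * y j) * (y (Suc j) - y j)
      + B * ((K j - K (Suc j)) * \<bar>y (Suc j)\<bar>)" for j
  proof (cases "snd (stopped_transform m \<epsilon> h y j)")
    case False
    then show ?thesis by (simp add: S_def K_def \<Psi>_def Let_def split_beta)
  next
    case True
    define v where "v = clip m (y (Suc j))"
    have b: "\<bar>S j\<bar> \<le> \<epsilon>" "\<bar>y j\<bar> \<le> m"
      using stopped_transform_alive_bounds[OF assms(1) True] by (simp_all add: S_def)
    have K: "K j = 1" and S: "S (Suc j) = S j + h j * (v - y j)"
      using True by (simp_all add: K_def S_def v_def Let_def split_beta)
    have "(h j)\<^sup>2 \<le> c\<^sup>2" using h[of j] by (rule abs_le_square_iff[THEN iffD1, OF order_trans]) simp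
    then have "(h j)\<^sup>2 * (v - y j)\<^sup>2 \<le> c\<^sup>2 * (v - y j)\<^sup>2" by (rule mult_right_mono) simp
    then have 1: "(S (Suc j))\<^sup>2 - (S j)\<^sup>2 \<le>
        c\<^sup>2 * (v\<^sup>2 - (y j)\<^sup>2) + (2 * S j * h j - 2 * c\<^sup>2 * y j) * (v - y j)"
      unfolding S by (simp add: power2_eq_square algebra_simps)
    have "\<bar>2 * S j * h j - 2 * c\<^sup>2 * y j\<bar> \<le> \<bar>2 * S j * h j\<bar> + \<bar>2 * c\<^sup>2 * y j\<bar>"
      by (rule abs_triangle_ineq4)
    also have "\<dots> = 2 * (\<bar>S j\<bar> * \<bar>h j\<bar>) + 2 * (c\<^sup>2 * \<bar>y j\<bar>)" by (simp add: abs_mult)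
    also have "\<dots> \<le> 2 * (\<epsilon> * c) + 2 * (c\<^sup>2 * m)"
      using b h[of j] c assms by (intro add_mono mult_left_mono mult_mono) auto
    finally have \<zeta>: "\<bar>2 * S j * h j - 2 * c\<^sup>2 * y j\<bar> \<le> B" by (simp add: B_def mult_ac)
    show ?thesis
    proof (cases "snd (stopped_transform m \<epsilon> h y (Suc j))")
      case True
      then have "K (Suc j) = 1" "v = y (Suc j)"
        using stopped_transform_alive_bounds(2)[OF assms(1) True]
        by (auto simp: K_def v_def clip_def)
      then show ?thesis using 1 K by (simp add: \<Psi>_def)
    next
      case False
      then have K': "K (Suc j) = 0" by (simp add: K_def)
      have v: "\<bar>v\<bar> \<le> m" "\<bar>v - y (Suc j)\<bar> \<le> \<bar>y (Suc j)\<bar>"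
        using assms(2) by (auto simp: v_def clip_def)
      have "v\<^sup>2 \<le> m\<^sup>2" using v(1) by (rule abs_le_square_iff[THEN iffD1, OF order_trans]) simp
      then have "c\<^sup>2 * (v\<^sup>2 - (y j)\<^sup>2) \<le> c\<^sup>2 * (m\<^sup>2 - (y j)\<^sup>2)" by (intro mult_left_mono) auto
      moreover have "(2 * S j * h j - 2 * c\<^sup>2 * y j) * (v - y (Suc j)) \<le> B * \<bar>y (Suc j)\<bar>"
      proof -
        have "\<bar>(2 * S j * h j - 2 * c\<^sup>2 * y j) * (v - y (Suc j))\<bar> \<le> B * \<bar>y (Suc j)\<bar>"
          unfolding abs_mult using \<zeta> v(2) B by (intro mult_mono) auto
        then show ?thesis by linarith
      qed
      moreover have "(2 * S j * h j - 2 * c\<^sup>2 * y j) * (v - y j) =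
          (2 * S j * h j - 2 * c\<^sup>2 * y j) * (v - y (Suc j)) +
          (2 * S j * h j - 2 * c\<^sup>2 * y j) * (y (Suc j) - y j)"
        by (simp add: algebra_simps)
      ultimately show ?thesis using 1 K K' by (simp add: \<Psi>_def)
    qed
  qed
  have Kdec: "K (Suc j) \<le> K j" for j
    by (auto simp: K_def Let_def split_beta)
  have K01: "0 \<le> K j" "K j \<le> 1" for j by (simp_all add: K_def)
  have "S 0 = 0" by (simp add: S_def)
  then have "(S n)\<^sup>2 = (\<Sum>j<n. (S (Suc j))\<^sup>2 - (S j)\<^sup>2)"
    by (simp add: sum_lessThan_telescope[of "\<lambda>j. (S j)\<^sup>2"])
  also have "\<dots> \<le> (\<Sum>j<n. c\<^sup>2 * (\<Psi> (Suc j) - \<Psi> j)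
      + K j * (2 * S j * h j - 2 * c\<^sup>2 * y j) * (y (Suc j) - y j)
      + B * ((K j - K (Suc j)) * \<bar>y (Suc j)\<bar>))"
    by (rule sum_mono) (rule step)
  also have "\<dots> = c\<^sup>2 * (\<Psi> n - \<Psi> 0)
      + (\<Sum>j<n. K j * (2 * S j * h j - 2 * c\<^sup>2 * y j) * (y (Suc j) - y j))
      + B * (\<Sum>j<n. (K j - K (Suc j)) * \<bar>y (Suc j)\<bar>)"
    by (simp add: sum.distrib flip: sum_distrib_left add: sum_lessThan_telescope)
  finally have main: "(S n)\<^sup>2 \<le> c\<^sup>2 * (\<Psi> n - \<Psi> 0)
      + (\<Sum>j<n. K j * (2 * S j * h j - 2 * c\<^sup>2 * y j) * (y (Suc j) - y j))
      + B * (\<Sum>j<n. (K j - K (Suc j)) * \<bar>y (Suc j)\<bar>)" .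
  have "\<Psi> n \<le> m\<^sup>2"
    using stopped_transform_alive_bounds(2)[OF assms(1), of m h y n] assms(2)
      power_mono[of "\<bar>y n\<bar>" m 2]
    by (auto simp: \<Psi>_def K_def)
  moreover have "0 \<le> \<Psi> 0" using K01[of 0] by (simp add: \<Psi>_def)
  ultimately have \<Psi>: "c\<^sup>2 * (\<Psi> n - \<Psi> 0) \<le> c\<^sup>2 * m\<^sup>2" by (intro mult_left_mono) auto
  have "(\<Sum>j<n. (K j - K (Suc j)) * \<bar>y (Suc j)\<bar>) =
      (\<Sum>j<n. (K j - K (Suc j)) * (sgn (y (Suc j)) * y n)
        - (K j - K (Suc j)) * sgn (y (Suc j)) * (y n - y (Suc j)))"
    by (rule sum.cong) (auto simp: algebra_simps sgn_mult_self_eq abs_sgn)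
  also have "\<dots> = (\<Sum>j<n. (K j - K (Suc j)) * (sgn (y (Suc j)) * y n))
      - (\<Sum>j<n. (K j - K (Suc j)) * sgn (y (Suc j)) * (y n - y (Suc j)))"
    by (rule sum_subtractf)
  also have "(\<Sum>j<n. (K j - K (Suc j)) * (sgn (y (Suc j)) * y n)) \<le> (\<Sum>j<n. (K j - K (Suc j)) * \<bar>y n\<bar>)"
    using Kdec by (intro sum_mono mult_left_mono) (auto simp: sgn_if)
  also have "(\<Sum>j<n. (K j - K (Suc j)) * \<bar>y n\<bar>) = (K 0 - K n) * \<bar>y n\<bar>"
    by (simp add: sum_lessThan_telescope' flip: sum_distrib_right)
  also have "(K 0 - K n) * \<bar>y n\<bar> \<le> 1 * \<bar>y n\<bar>"
    using K01[of 0] K01[of n] by (intro mult_right_mono) auto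
  finally have "(\<Sum>j<n. (K j - K (Suc j)) * \<bar>y (Suc j)\<bar>) \<le> \<bar>y n\<bar>
      - (\<Sum>j<n. (K j - K (Suc j)) * sgn (y (Suc j)) * (y n - y (Suc j)))" by simp
  from mult_left_mono[OF this B] main \<Psi> show ?thesis by (simp add: right_diff_distrib)
qed

lemma measurable_stopped_transform:
  assumes mono: "\<And>i j. i \<le> j \<Longrightarrow> j \<le> n \<Longrightarrow> subalgebra (G j) (G i)"
    and y: "\<And>i. i \<le> n \<Longrightarrow> y i \<in> borel_measurable (G i)"
    and h: "\<And>i. i < n \<Longrightarrow> h i \<in> borel_measurable (G i)"
    and "j \<le> n"
  shows "(\<lambda>\<omega>. fst (stopped_transform m \<epsilon> (\<lambda>i. h i \<omega>) (\<lambda>i. y i \<omega>) j)) \<in> borel_measurable (G j) \<and>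
    Measurable.pred (G j) (\<lambda>\<omega>. snd (stopped_transform m \<epsilon> (\<lambda>i. h i \<omega>) (\<lambda>i. y i \<omega>) j))"
  using \<open>j \<le> n\<close>
proof (induction j)
  case 0
  then have [measurable]: "y 0 \<in> borel_measurable (G 0)" by (intro y)
  show ?case by simp
next
  case (Suc j)
  have s: "subalgebra (G (Suc j)) (G j)" using Suc.prems by (intro mono) auto
  have [measurable]: "y (Suc j) \<in> borel_measurable (G (Suc j))" using Suc.prems by (intro y)
  have [measurable]: "y j \<in> borel_measurable (G (Suc j))" "h j \<in> borel_measurable (G (Suc j))"
    using Suc.prems by (auto intro!: measurable_from_subalg[OF s] y h)
  have [measurable]: "(\<lambda>\<omega>. fst (stopped_transform m \<epsilon> (\<lambda>i. h i \<omega>) (\<lambda>i. y i \<omega>) j)) \<in> borel_measurable (G (Suc j))"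
    "Measurable.pred (G (Suc j)) (\<lambda>\<omega>. snd (stopped_transform m \<epsilon> (\<lambda>i. h i \<omega>) (\<lambda>i. y i \<omega>) j))"
    using Suc by (auto intro!: measurable_from_subalg[OF s])
  show ?case
    unfolding stopped_transform.simps Let_def split_beta fst_conv snd_conv clip_def by measurable
qed

text \<open>
  A weak-type estimate: it asks only for integrability of the martingale, and it is linear in \<open>c\<close> for
  small \<open>c\<close>. Both matter below, as the stopped local martingale need not be square integrable, and the
  bounds have to be summable along \<open>c = 1 / k\<^sup>2\<close>.
\<close>

lemma (in prob_space) martingale_transform_prob_le:
  fixes G :: "nat \<Rightarrow> 'a measure" and y h :: "nat \<Rightarrow> 'a \<Rightarrow> real"
  assumes sub: "\<And>i. i \<le> n \<Longrightarrow> subalgebra M (G i)"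
    and mono: "\<And>i j. i \<le> j \<Longrightarrow> j \<le> n \<Longrightarrow> subalgebra (G j) (G i)"
    and y: "\<And>i. i \<le> n \<Longrightarrow> y i \<in> borel_measurable (G i)"
    and int: "\<And>i. i \<le> n \<Longrightarrow> integrable M (y i)"
    and mart: "\<And>i \<zeta> C. i \<le> n \<Longrightarrow> \<zeta> \<in> borel_measurable (G i) \<Longrightarrow> (\<And>\<omega>. \<bar>\<zeta> \<omega>\<bar> \<le> C) \<Longrightarrow>
      expectation (\<lambda>\<omega>. \<zeta> \<omega> * y n \<omega>) = expectation (\<lambda>\<omega>. \<zeta> \<omega> * y i \<omega>)"
    and h: "\<And>i. i < n \<Longrightarrow> h i \<in> borel_measurable (G i)"
    and hc: "\<And>i \<omega>. \<bar>h i \<omega>\<bar> \<le> c"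
    and \<epsilon>: "0 < \<epsilon>" and m: "0 \<le> m"
  shows "prob {\<omega> \<in> space M. (\<forall>i\<le>n. \<bar>y i \<omega>\<bar> \<le> m) \<and>
      \<epsilon> < \<bar>\<Sum>i<n. h i \<omega> * (y (Suc i) \<omega> - y i \<omega>)\<bar>}
    \<le> (c\<^sup>2 * m\<^sup>2 + (2 * c * \<epsilon> + 2 * c\<^sup>2 * m) * expectation (\<lambda>\<omega>. \<bar>y n \<omega>\<bar>)) / \<epsilon>\<^sup>2"
    (is "prob ?A \<le> _")
proof -
  define S where "S j \<omega> = fst (stopped_transform m \<epsilon> (\<lambda>i. h i \<omega>) (\<lambda>i. y i \<omega>) j)" for j \<omega>
  define K where "K j \<omega> = (of_bool (snd (stopped_transform m \<epsilon> (\<lambda>i. h i \<omega>) (\<lambda>i. y i \<omega>) j)) :: real)" for j \<omega>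
  define B where "B = 2 * c * \<epsilon> + 2 * c\<^sup>2 * m"
  define \<zeta> where "\<zeta> j \<omega> = K j \<omega> * (2 * S j \<omega> * h j \<omega> - 2 * c\<^sup>2 * y j \<omega>)" for j \<omega>
  define \<theta> where "\<theta> j \<omega> = (K j \<omega> - K (Suc j) \<omega>) * sgn (y (Suc j) \<omega>)" for j \<omega>
  have c: "0 \<le> c" using hc[of 0 undefined] by linarith
  have meas: "f \<in> borel_measurable M" if "i \<le> n" "f \<in> borel_measurable (G i)" for f :: "'a \<Rightarrow> real" and i
    using measurable_from_subalg[OF sub[OF that(1)] that(2)] .
  have Sm: "S j \<in> borel_measurable (G j)" and Km: "K j \<in> borel_measurable (G j)" if "j \<le> n" for j
  proof -
    have [measurable]: "(\<lambda>\<omega>. fst (stopped_transform m \<epsilon> (\<lambda>i. h i \<omega>) (\<lambda>i. y i \<omega>) j)) \<in> borel_measurable (G j)"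
      "Measurable.pred (G j) (\<lambda>\<omega>. snd (stopped_transform m \<epsilon> (\<lambda>i. h i \<omega>) (\<lambda>i. y i \<omega>) j))"
      using measurable_stopped_transform[where n = n and y = y and h = h and G = G, OF mono y h that]
      by simp_all
    show "S j \<in> borel_measurable (G j)" "K j \<in> borel_measurable (G j)"
      unfolding S_def[abs_def] K_def[abs_def] by measurable
  qed
  have \<zeta>m: "\<zeta> j \<in> borel_measurable (G j)" if "j < n" for j
  proof -
    have [measurable]: "S j \<in> borel_measurable (G j)" "K j \<in> borel_measurable (G j)"
      "y j \<in> borel_measurable (G j)" "h j \<in> borel_measurable (G j)"
      using that by (auto intro: Sm Km y h)
    show ?thesis unfolding \<zeta>_def[abs_def] by measurable
  qed
  have \<theta>m: "\<theta> j \<in> borel_measurable (G (Suc j))" if "j < n" for j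
  proof -
    have [measurable]: "K j \<in> borel_measurable (G (Suc j))" "K (Suc j) \<in> borel_measurable (G (Suc j))"
      "y (Suc j) \<in> borel_measurable (G (Suc j))"
      using that measurable_from_subalg[OF mono[of j "Suc j"] Km[of j]] by (auto intro: Km y)
    show ?thesis unfolding \<theta>_def[abs_def] by measurable
  qed
  have \<zeta>b: "\<bar>\<zeta> j \<omega>\<bar> \<le> B" for j \<omega>
  proof (cases "snd (stopped_transform m \<epsilon> (\<lambda>i. h i \<omega>) (\<lambda>i. y i \<omega>) j)")
    case True
    note b = stopped_transform_alive_bounds[OF less_imp_le[OF \<epsilon>] True]
    have "\<bar>2 * S j \<omega> * h j \<omega> - 2 * c\<^sup>2 * y j \<omega>\<bar> \<le> \<bar>2 * S j \<omega> * h j \<omega>\<bar> + \<bar>2 * c\<^sup>2 * y j \<omega>\<bar>"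
      by (rule abs_triangle_ineq4)
    also have "\<dots> = 2 * (\<bar>S j \<omega>\<bar> * \<bar>h j \<omega>\<bar>) + 2 * (c\<^sup>2 * \<bar>y j \<omega>\<bar>)" by (simp add: abs_mult)
    also have "\<dots> \<le> 2 * (\<epsilon> * c) + 2 * (c\<^sup>2 * m)"
      using b hc[of j \<omega>] c \<epsilon> by (intro add_mono mult_left_mono mult_mono) (auto simp: S_def)
    finally show ?thesis using True by (simp add: \<zeta>_def K_def B_def mult_ac)
  next
    case False
    then show ?thesis using c \<epsilon> m by (simp add: \<zeta>_def K_def B_def)
  qed
  have \<theta>b: "\<bar>\<theta> j \<omega>\<bar> \<le> 1" for j \<omega>
    by (auto simp: \<theta>_def K_def abs_mult sgn_if)
  have int_mult: "integrable M (\<lambda>\<omega>. z \<omega> * y i \<omega>)"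
    if "i \<le> n" "j \<le> n" "z \<in> borel_measurable (G j)" "\<And>\<omega>. \<bar>z \<omega>\<bar> \<le> C" for z i j C
  proof (rule Bochner_Integration.integrable_bound)
    show "integrable M (\<lambda>\<omega>. C * y i \<omega>)" using int that by simp
    show "(\<lambda>\<omega>. z \<omega> * y i \<omega>) \<in> borel_measurable M"
      using meas[OF that(2,3)] meas[OF that(1) y[OF that(1)]] by simp
    have "\<bar>z \<omega>\<bar> \<le> \<bar>C\<bar>" for \<omega> using that(4)[of \<omega>] by linarith
    then show "AE \<omega> in M. norm (z \<omega> * y i \<omega>) \<le> norm (C * y i \<omega>)"
      by (auto simp: abs_mult intro!: mult_right_mono)
  qed
  have \<zeta>0: "integrable M (\<lambda>\<omega>. \<zeta> j \<omega> * (y (Suc j) \<omega> - y j \<omega>))"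
      "expectation (\<lambda>\<omega>. \<zeta> j \<omega> * (y (Suc j) \<omega> - y j \<omega>)) = 0" if "j < n" for j
  proof -
    have i: "integrable M (\<lambda>\<omega>. \<zeta> j \<omega> * y (Suc j) \<omega>)" "integrable M (\<lambda>\<omega>. \<zeta> j \<omega> * y j \<omega>)"
      using that by (auto intro!: int_mult[OF _ _ \<zeta>m \<zeta>b])
    have "\<zeta> j \<in> borel_measurable (G (Suc j))"
      using that by (intro measurable_from_subalg[OF mono \<zeta>m]) auto
    then have "expectation (\<lambda>\<omega>. \<zeta> j \<omega> * y (Suc j) \<omega>) = expectation (\<lambda>\<omega>. \<zeta> j \<omega> * y j \<omega>)"
      using mart[of j "\<zeta> j" B] mart[of "Suc j" "\<zeta> j" B] \<zeta>m \<zeta>b that by simp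
    then show "integrable M (\<lambda>\<omega>. \<zeta> j \<omega> * (y (Suc j) \<omega> - y j \<omega>))"
      "expectation (\<lambda>\<omega>. \<zeta> j \<omega> * (y (Suc j) \<omega> - y j \<omega>)) = 0"
      using i by (simp_all add: right_diff_distrib)
  qed
  have \<theta>0: "integrable M (\<lambda>\<omega>. \<theta> j \<omega> * (y n \<omega> - y (Suc j) \<omega>))"
      "expectation (\<lambda>\<omega>. \<theta> j \<omega> * (y n \<omega> - y (Suc j) \<omega>)) = 0" if "j < n" for j
  proof -
    have i: "integrable M (\<lambda>\<omega>. \<theta> j \<omega> * y n \<omega>)" "integrable M (\<lambda>\<omega>. \<theta> j \<omega> * y (Suc j) \<omega>)"
      using that by (auto intro!: int_mult[OF _ _ \<theta>m \<theta>b])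
    have "expectation (\<lambda>\<omega>. \<theta> j \<omega> * y n \<omega>) = expectation (\<lambda>\<omega>. \<theta> j \<omega> * y (Suc j) \<omega>)"
      using mart[of "Suc j" "\<theta> j" 1] \<theta>m \<theta>b that by simp
    then show "integrable M (\<lambda>\<omega>. \<theta> j \<omega> * (y n \<omega> - y (Suc j) \<omega>))"
      "expectation (\<lambda>\<omega>. \<theta> j \<omega> * (y n \<omega> - y (Suc j) \<omega>)) = 0"
      using i by (simp_all add: right_diff_distrib)
  qed
  define Z where "Z \<omega> = c\<^sup>2 * m\<^sup>2 + B * \<bar>y n \<omega>\<bar> + (\<Sum>j<n. \<zeta> j \<omega> * (y (Suc j) \<omega> - y j \<omega>))
      - B * (\<Sum>j<n. \<theta> j \<omega> * (y n \<omega> - y (Suc j) \<omega>))" for \<omega>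
  have I1: "integrable M (\<lambda>\<omega>. \<Sum>j<n. \<zeta> j \<omega> * (y (Suc j) \<omega> - y j \<omega>))"
    and I2: "integrable M (\<lambda>\<omega>. \<Sum>j<n. \<theta> j \<omega> * (y n \<omega> - y (Suc j) \<omega>))"
    by (intro Bochner_Integration.integrable_sum \<zeta>0(1) \<theta>0(1); simp)+
  have "expectation (\<lambda>\<omega>. \<Sum>j<n. \<zeta> j \<omega> * (y (Suc j) \<omega> - y j \<omega>)) =
      (\<Sum>j<n. expectation (\<lambda>\<omega>. \<zeta> j \<omega> * (y (Suc j) \<omega> - y j \<omega>)))"
    by (rule Bochner_Integration.integral_sum) (simp add: \<zeta>0(1))
  then have E1: "expectation (\<lambda>\<omega>. \<Sum>j<n. \<zeta> j \<omega> * (y (Suc j) \<omega> - y j \<omega>)) = 0"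
    by (simp add: \<zeta>0(2))
  have "expectation (\<lambda>\<omega>. \<Sum>j<n. \<theta> j \<omega> * (y n \<omega> - y (Suc j) \<omega>)) =
      (\<Sum>j<n. expectation (\<lambda>\<omega>. \<theta> j \<omega> * (y n \<omega> - y (Suc j) \<omega>)))"
    by (rule Bochner_Integration.integral_sum) (simp add: \<theta>0(1))
  then have E2: "expectation (\<lambda>\<omega>. \<Sum>j<n. \<theta> j \<omega> * (y n \<omega> - y (Suc j) \<omega>)) = 0"
    by (simp add: \<theta>0(2))
  have ZI: "integrable M Z" unfolding Z_def[abs_def]
    using I1 I2 int[of n] by (intro Bochner_Integration.integrable_diff Bochner_Integration.integrable_add
        integrable_mult_right integrable_const integrable_abs) auto
  have EZ: "expectation Z = c\<^sup>2 * m\<^sup>2 + B * expectation (\<lambda>\<omega>. \<bar>y n \<omega>\<bar>)"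
    unfolding Z_def[abs_def] using I1 I2 E1 E2 int[of n] by (simp add: prob_space)
  have SZ: "(S n \<omega>)\<^sup>2 \<le> Z \<omega>" for \<omega>
    using stopped_transform_square_le[of \<epsilon> m "\<lambda>i. h i \<omega>" c "\<lambda>i. y i \<omega>" n] \<epsilon> m hc
    by (simp add: Z_def S_def K_def B_def \<zeta>_def \<theta>_def)
  have ym[measurable]: "y i \<in> borel_measurable M" if "i \<le> n" for i using meas[OF that y[OF that]] .
  have hm[measurable]: "h i \<in> borel_measurable M" if "i < n" for i using meas[of i, OF _ h] that by simp
  have A: "?A \<in> events"
  proof -
    have "(\<lambda>\<omega>. \<Sum>i<n. h i \<omega> * (y (Suc i) \<omega> - y i \<omega>)) \<in> borel_measurable M"
      by (auto intro!: borel_measurable_sum borel_measurable_times borel_measurable_diff ym hm)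
    moreover have "Measurable.pred M (\<lambda>\<omega>. \<forall>i\<in>{..n}. \<bar>y i \<omega>\<bar> \<le> m)"
      by (intro pred_intros_finite) (auto intro!: ym)
    ultimately show ?thesis by (simp add: Ball_def)
  qed
  have "\<epsilon>\<^sup>2 * prob ?A = expectation (\<lambda>\<omega>. \<epsilon>\<^sup>2 * indicator ?A \<omega>)"
    using A by simp
  also have "\<dots> \<le> expectation Z"
  proof (rule integral_mono[OF _ ZI])
    have "emeasure M ?A < \<infinity>" by (simp only: emeasure_eq_measure ennreal_less_top infinity_ennreal_def)
    then show "integrable M (\<lambda>\<omega>. \<epsilon>\<^sup>2 * indicator ?A \<omega> :: real)"
      by (intro integrable_mult_right integrable_real_indicator A)
    fix \<omega>
    show "\<epsilon>\<^sup>2 * indicator ?A \<omega> \<le> Z \<omega>"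
    proof (cases "\<omega> \<in> ?A")
      case True
      then have "\<epsilon> < \<bar>S n \<omega>\<bar>"
        using stopped_transform_large[of \<epsilon> n "\<lambda>i. y i \<omega>" m "\<lambda>i. h i \<omega>"] \<epsilon> by (simp add: S_def)
      then have "\<epsilon>\<^sup>2 \<le> (S n \<omega>)\<^sup>2" using \<epsilon> by (simp flip: abs_le_square_iff)
      then show ?thesis using True SZ[of \<omega>] by simp
    next
      case False
      then have "indicator ?A \<omega> = (0::real)" by (rule indicator_simps(2))
      then show ?thesis using order_trans[OF zero_le_power2 SZ] by (simp only: mult_zero_right)
    qed
  qed
  finally show ?thesis using \<epsilon> by (simp add: EZ B_def field_simps)
qed

section \<open>From grids to paths of semimartingales\<close>

lemma grid_variation_le:
  assumes fin: "finite_variation_on a 0 T" and t: "0 \<le> t" "t \<le> T"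
  shows "(\<Sum>i<N. \<bar>a (grid t N (Suc i)) - a (grid t N i)\<bar>) \<le> enn2real (truncated_variation 0 a 0 T)"
proof (cases "t = 0 \<or> N = 0")
  case True
  then show ?thesis by (auto simp: grid_def)
next
  case False
  then have pos: "0 < t" "0 < N" using t by auto
  define p where "p i = grid t N (i - 1)" for i
  have "grid t N i \<in> {0..T}" if "i \<le> N" for i using grid_mem[OF t(1) that] t(2) by auto
  moreover have "strict_mono_on {1..Suc N} p"
    using pos by (intro strict_mono_onI) (auto simp: p_def grid_def divide_strict_right_mono)
  ultimately have "(Suc N, p) \<in> increasing_points 0 T"
    by (auto simp: increasing_points_def p_def)
  then have le: "ennreal (\<Sum>i = 1..<Suc N. trunc 0 \<bar>a (p (Suc i)) - a (p i)\<bar>) \<le> truncated_variation 0 a 0 T"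
    unfolding truncated_variation_def by (rule SUP_upper2) simp
  have eq: "(\<Sum>i = 1..<Suc N. trunc 0 \<bar>a (p (Suc i)) - a (p i)\<bar>) =
      (\<Sum>i<N. \<bar>a (grid t N (Suc i)) - a (grid t N i)\<bar>)"
    by (simp only: One_nat_def sum.shift_bounds_Suc_ivl) (simp add: p_def trunc_def atLeast0LessThan)
  have "enn2real (ennreal (\<Sum>i<N. \<bar>a (grid t N (Suc i)) - a (grid t N i)\<bar>)) \<le> enn2real (truncated_variation 0 a 0 T)"
    using le fin unfolding eq by (intro enn2real_mono) (auto simp: finite_variation_on_def)
  then show ?thesis by (simp add: sum_nonneg)
qed

lemma play_square_sum_vanishes:
  assumes c: "0 < c" and t: "0 \<le> t" and f: "continuous_on {0..t} f" and \<epsilon>: "0 < \<epsilon>"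
  shows "\<forall>\<^sub>F N in sequentially. (\<Sum>i<N. (play (c / 2) (\<lambda>i. f (grid t N i)) (Suc i) -
    play (c / 2) (\<lambda>i. f (grid t N i)) i)\<^sup>2) \<le> \<epsilon>"
proof -
  define K where "K = TV c f 0 t + 2 * c"
  have K: "0 < K" using c unfolding K_def by (intro add_nonneg_pos) auto
  have "uniformly_continuous_on {0..t} f"
    using f compact_uniformly_continuous by blast
  then obtain d where d: "d > 0"
      "\<And>x y. x \<in> {0..t} \<Longrightarrow> y \<in> {0..t} \<Longrightarrow> dist y x < d \<Longrightarrow> dist (f y) (f x) < \<epsilon> / K"
    using \<epsilon> K unfolding uniformly_continuous_on_def by (metis divide_pos_pos)
  have "(\<lambda>N. t / real N) \<longlonglongrightarrow> 0" by (rule lim_const_over_n)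
  then have "\<forall>\<^sub>F N in sequentially. t / real N < d" using d by (intro order_tendstoD) auto
  then show ?thesis using eventually_gt_at_top[of 0]
  proof eventually_elim
    case (elim N)
    define g where "g = play (c / 2) (\<lambda>i. f (grid t N i))"
    have "(g (Suc i) - g i)\<^sup>2 \<le> \<epsilon> / K * \<bar>g (Suc i) - g i\<bar>" if "i < N" for i
    proof -
      have "dist (grid t N (Suc i)) (grid t N i) < d"
        using elim t by (simp add: dist_real_def grid_step)
      then have "\<bar>f (grid t N (Suc i)) - f (grid t N i)\<bar> < \<epsilon> / K"
        using d(2)[of "grid t N i" "grid t N (Suc i)"] grid_mem[OF t, of i N] grid_mem[OF t, of "Suc i" N] that
        by (simp add: dist_real_def)
      moreover have "\<bar>g (Suc i) - g i\<bar> \<le> \<bar>f (grid t N (Suc i)) - f (grid t N i)\<bar>"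
        unfolding g_def using c by (intro play_step_le) simp
      ultimately have "\<bar>g (Suc i) - g i\<bar> * \<bar>g (Suc i) - g i\<bar> \<le> \<epsilon> / K * \<bar>g (Suc i) - g i\<bar>"
        by (intro mult_right_mono) auto
      then show ?thesis by (simp add: power2_eq_square)
    qed
    then have "(\<Sum>i<N. (g (Suc i) - g i)\<^sup>2) \<le> (\<Sum>i<N. \<epsilon> / K * \<bar>g (Suc i) - g i\<bar>)"
      by (intro sum_mono) auto
    also have "\<dots> = \<epsilon> / K * (rise g N + fall g N)"
      by (simp add: rise_plus_fall sum_distrib_left)
    also have "\<dots> \<le> \<epsilon> / K * K"
      unfolding K_def[symmetric] using play_variation_le_truncated_variation(1)[OF c t f, of N] elim \<epsilon> K
      by (intro mult_left_mono) (auto simp: K_def g_def)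
    finally show ?case using K by (simp add: g_def)
  qed
qed

lemma semimartingale_path_near:
  fixes f m a :: "real \<Rightarrow> real"
  assumes c: "0 < c" and t: "0 \<le> t" and f: "continuous_on {0..t} f"
    and R: "\<And>s. s \<in> {0..t} \<Longrightarrow> \<bar>f s\<bar> \<le> R"
    and decomp: "\<And>s. s \<in> {0..t} \<Longrightarrow> f s = f 0 + m s + a s"
    and V: "\<And>N. (\<Sum>i<N. \<bar>a (grid t N (Suc i)) - a (grid t N i)\<bar>) \<le> V"
    and \<epsilon>: "0 < \<epsilon>"
    and freq: "\<exists>\<^sub>F N in sequentially.
      \<bar>(\<Sum>i<N. (f (grid t N (Suc i)) - f (grid t N i))\<^sup>2) - q\<bar> \<le> \<epsilon> \<and>
      \<bar>\<Sum>i<N. 2 * (f (grid t N i) - play (c / 2) (\<lambda>i. f (grid t N i)) i) *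
        (m (grid t N (Suc i)) - m (grid t N i))\<bar> \<le> \<epsilon>"
  defines "e \<equiv> 3 * \<epsilon> + c * V + c * R + 4 * c\<^sup>2"
  shows "\<bar>c * TV c f 0 t - q\<bar> \<le> e" and "\<bar>c * UTV c f 0 t - q / 2\<bar> \<le> e"
    and "\<bar>c * DTV c f 0 t - q / 2\<bar> \<le> e"
proof -
  have "\<exists>\<^sub>F N in sequentially.
      \<bar>c * (rise (play (c / 2) (\<lambda>i. f (grid t N i))) N + fall (play (c / 2) (\<lambda>i. f (grid t N i))) N) - q\<bar>
        \<le> 3 * \<epsilon> + c * V + c\<^sup>2"
    using frequently_eventually_frequently[OF freq play_square_sum_vanishes[OF c t f \<epsilon>]]
  proof (rule frequently_elim1)
    fix N
    define x where "x = (\<lambda>i. f (grid t N i))"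
    define g where "g = play (c / 2) x"
    define dm da where "dm i = m (grid t N (Suc i)) - m (grid t N i)"
      and "da i = a (grid t N (Suc i)) - a (grid t N i)" for i
    assume "(\<bar>(\<Sum>i<N. (f (grid t N (Suc i)) - f (grid t N i))\<^sup>2) - q\<bar> \<le> \<epsilon> \<and>
      \<bar>\<Sum>i<N. 2 * (f (grid t N i) - play (c / 2) (\<lambda>i. f (grid t N i)) i) *
        (m (grid t N (Suc i)) - m (grid t N i))\<bar> \<le> \<epsilon>) \<and>
      (\<Sum>i<N. (play (c / 2) (\<lambda>i. f (grid t N i)) (Suc i) - play (c / 2) (\<lambda>i. f (grid t N i)) i)\<^sup>2) \<le> \<epsilon>"
    then have 1: "\<bar>(\<Sum>i<N. (x (Suc i) - x i)\<^sup>2) - q\<bar> \<le> \<epsilon>"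
      and 2: "\<bar>\<Sum>i<N. 2 * (x i - g i) * dm i\<bar> \<le> \<epsilon>"
      and 3: "(\<Sum>i<N. (g (Suc i) - g i)\<^sup>2) \<le> \<epsilon>"
      by (simp_all add: x_def g_def dm_def)
    have u: "\<bar>x i - g i\<bar> \<le> c / 2" for i
      unfolding g_def using c by (intro play_close) simp
    have "x (Suc i) - x i = dm i + da i" if "i < N" for i
      using decomp[OF grid_mem[OF t, of i N]] decomp[OF grid_mem[OF t, of "Suc i" N]] that
      by (simp add: x_def dm_def da_def)
    then have "(\<Sum>i<N. 2 * (x i - g i) * (x (Suc i) - x i)) =
        (\<Sum>i<N. 2 * (x i - g i) * dm i + 2 * (x i - g i) * da i)"
      by (intro sum.cong) (auto simp: distrib_left)
    moreover have "2 * (\<Sum>i<N. (x i - g i) * (x (Suc i) - x i)) = (\<Sum>i<N. 2 * (x i - g i) * (x (Suc i) - x i))"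
      by (simp only: sum_distrib_left mult.assoc)
    ultimately have 4: "2 * (\<Sum>i<N. (x i - g i) * (x (Suc i) - x i)) =
        (\<Sum>i<N. 2 * (x i - g i) * dm i) + (\<Sum>i<N. 2 * (x i - g i) * da i)"
      by (simp only: sum.distrib)
    have "\<bar>\<Sum>i<N. 2 * (x i - g i) * da i\<bar> \<le> (\<Sum>i<N. \<bar>2 * (x i - g i) * da i\<bar>)"
      by (rule sum_abs)
    also have "\<dots> \<le> (\<Sum>i<N. c * \<bar>da i\<bar>)"
    proof (rule sum_mono)
      fix i
      have "\<bar>2 * (x i - g i)\<bar> \<le> c" using u[of i] by (simp only: abs_mult) simp
      then show "\<bar>2 * (x i - g i) * da i\<bar> \<le> c * \<bar>da i\<bar>"
        unfolding abs_mult[of "2 * (x i - g i)"] by (rule mult_right_mono) simp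
    qed
    also have "\<dots> \<le> c * V"
      using V[of N] c by (simp add: da_def flip: sum_distrib_left)
    finally have 5: "\<bar>\<Sum>i<N. 2 * (x i - g i) * da i\<bar> \<le> c * V" .
    have "\<bar>x N - g N\<bar> \<le> \<bar>c\<bar>" using u[of N] c by simp
    then have 6: "(x N - g N)\<^sup>2 \<le> c\<^sup>2" by (simp only: abs_le_square_iff)
    have 7: "0 \<le> (\<Sum>i<N. (g (Suc i) - g i)\<^sup>2)" by (intro sum_nonneg) simp
    have "c * (rise g N + fall g N) =
      (\<Sum>i<N. (x (Suc i) - x i)\<^sup>2) + 2 * (\<Sum>i<N. (x i - g i) * (x (Suc i) - x i))
      - (\<Sum>i<N. (g (Suc i) - g i)\<^sup>2) - (x N - g N)\<^sup>2"
      using play_identity[of "c / 2" x N] c by (simp add: g_def)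
    then have "\<bar>c * (rise g N + fall g N) - q\<bar> \<le> 3 * \<epsilon> + c * V + c\<^sup>2"
      using 1 2 3 5 6 7 zero_le_power2[of "x N - g N"] unfolding 4 abs_le_iff by linarith
    then show "\<bar>c * (rise (play (c / 2) (\<lambda>i. f (grid t N i))) N +
        fall (play (c / 2) (\<lambda>i. f (grid t N i))) N) - q\<bar> \<le> 3 * \<epsilon> + c * V + c\<^sup>2"
      by (simp add: g_def x_def)
  qed
  from truncated_variations_near[OF c t f R this]
  show "\<bar>c * TV c f 0 t - q\<bar> \<le> e" "\<bar>c * UTV c f 0 t - q / 2\<bar> \<le> e"
    "\<bar>c * DTV c f 0 t - q / 2\<bar> \<le> e"
    unfolding e_def by (simp_all add: algebra_simps)
qed

section \<open>Almost sure convergence at a fixed time\<close>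

text \<open>
  Fatou's lemma for events: the intersections of the tails increase to the event in question.
\<close>

lemma (in prob_space) prob_eventually_le:
  assumes A: "\<And>N. A N \<in> events" and b: "\<forall>\<^sub>F N in sequentially. prob (A N) \<le> b"
  shows "{\<omega> \<in> space M. \<forall>\<^sub>F N in sequentially. \<omega> \<in> A N} \<in> events" (is "?E \<in> _")
    and "prob {\<omega> \<in> space M. \<forall>\<^sub>F N in sequentially. \<omega> \<in> A N} \<le> b"
proof -
  define C where "C n = (\<Inter>N\<in>{n..}. A N)" for n
  have C: "C n \<in> events" for n unfolding C_def using A by (intro sets.countable_INT') auto
  have E: "?E = (\<Union>n. C n)"
    using sets.sets_into_space[OF A] by (auto simp: C_def eventually_sequentially)
  show "?E \<in> events" unfolding E using C by auto
  obtain n0 where n0: "\<And>N. n0 \<le> N \<Longrightarrow> prob (A N) \<le> b"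
    using b by (auto simp: eventually_sequentially)
  have "prob (C n) \<le> b" for n
  proof -
    have "prob (C n) \<le> prob (A (max n n0))"
      using A by (intro finite_measure_mono) (auto simp: C_def)
    then show ?thesis using n0[of "max n n0"] by simp
  qed
  moreover have "(\<lambda>n. prob (C n)) \<longlonglongrightarrow> prob (\<Union>n. C n)"
    using C by (intro finite_Lim_measure_incseq) (auto simp: C_def incseq_def)
  ultimately show "prob ?E \<le> b" unfolding E by (intro LIMSEQ_le_const2) auto
qed

lemma measurable_play:
  assumes mono: "\<And>i j. i \<le> j \<Longrightarrow> j \<le> n \<Longrightarrow> subalgebra (G j) (G i)"
    and x: "\<And>i. i \<le> n \<Longrightarrow> x i \<in> borel_measurable (G i)"
    and "j \<le> n"
  shows "(\<lambda>\<omega>. play r (\<lambda>i. x i \<omega>) j) \<in> borel_measurable (G j)"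
  using \<open>j \<le> n\<close>
proof (induction j)
  case 0
  then show ?case using x[of 0] by simp
next
  case (Suc j)
  have [measurable]: "(\<lambda>\<omega>. play r (\<lambda>i. x i \<omega>) j) \<in> borel_measurable (G (Suc j))"
    using Suc by (intro measurable_from_subalg[OF mono[of j "Suc j"]]) auto
  have [measurable]: "x (Suc j) \<in> borel_measurable (G (Suc j))" using Suc.prems by (intro x)
  show ?case by simp
qed

lemma martingale_expectation_mult:
  assumes P: "filtered_prob_space P F" and Y: "martingale P F T Y"
    and st: "0 \<le> s" "s \<le> t" "t \<le> T"
    and \<zeta>: "\<zeta> \<in> borel_measurable (F s)" "\<And>\<omega>. \<bar>\<zeta> \<omega>\<bar> \<le> C"
  shows "(\<integral>\<omega>. \<zeta> \<omega> * Y t \<omega> \<partial>P) = (\<integral>\<omega>. \<zeta> \<omega> * Y s \<omega> \<partial>P)"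
proof -
  interpret prob_space P using P by (simp add: filtered_prob_space_def)
  have sub: "subalgebra P (F s)" using P by (simp add: filtered_prob_space_def)
  interpret sigma_finite_subalgebra P "F s"
    using sub by (intro finite_measure_subalgebra_is_sigma_finite finite_measure_subalgebra.intro
        finite_measure_subalgebra_axioms.intro finite_measure_axioms)
  have int: "integrable P (Y s)" "integrable P (Y t)"
    using Y st by (auto simp: martingale_def)
  have ce: "AE \<omega> in P. real_cond_exp P (F s) (Y t) \<omega> = Y s \<omega>"
    using Y st by (auto simp: martingale_def)
  have [measurable]: "\<zeta> \<in> borel_measurable P" using \<zeta>(1) sub by (rule measurable_from_subalg[rotated])
  have [measurable]: "Y s \<in> borel_measurable P" "Y t \<in> borel_measurable P" using int by auto
  have "integrable P (\<lambda>\<omega>. \<zeta> \<omega> * Y t \<omega>)"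
  proof (rule Bochner_Integration.integrable_bound)
    show "integrable P (\<lambda>\<omega>. C * Y t \<omega>)" using int by simp
    have "\<bar>\<zeta> \<omega>\<bar> \<le> \<bar>C\<bar>" for \<omega> using \<zeta>(2)[of \<omega>] by linarith
    then show "AE \<omega> in P. norm (\<zeta> \<omega> * Y t \<omega>) \<le> norm (C * Y t \<omega>)"
      by (auto simp: abs_mult intro!: mult_right_mono)
  qed measurable
  then have "(\<integral>\<omega>. \<zeta> \<omega> * Y t \<omega> \<partial>P) = (\<integral>\<omega>. \<zeta> \<omega> * real_cond_exp P (F s) (Y t) \<omega> \<partial>P)"
    using \<zeta>(1) by (intro real_cond_exp_intg(2)[symmetric]) auto
  also have "\<dots> = (\<integral>\<omega>. \<zeta> \<omega> * Y s \<omega> \<partial>P)"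
    using ce by (intro integral_cong_AE) auto
  finally show ?thesis .
qed

text \<open>
  The contribution of \<open>Y\<close> to the middle sum in the play identity for \<open>X\<close>.
\<close>

definition play_transform ::
    "(real \<Rightarrow> 'a \<Rightarrow> real) \<Rightarrow> (real \<Rightarrow> 'a \<Rightarrow> real) \<Rightarrow> real \<Rightarrow> real \<Rightarrow> nat \<Rightarrow> 'a \<Rightarrow> real"
  where "play_transform X Y c t N \<omega> =
    (\<Sum>i<N. 2 * (X (grid t N i) \<omega> - play (c / 2) (\<lambda>i. X (grid t N i) \<omega>) i) *
      (Y (grid t N (Suc i)) \<omega> - Y (grid t N i) \<omega>))"

definition grid_squares :: "(real \<Rightarrow> 'a \<Rightarrow> real) \<Rightarrow> real \<Rightarrow> nat \<Rightarrow> 'a \<Rightarrow> real"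
  where "grid_squares X t N \<omega> = (\<Sum>i<N. (X (grid t N (Suc i)) \<omega> - X (grid t N i) \<omega>)\<^sup>2)"

lemma play_transform_prob_le:
  assumes P: "filtered_prob_space P F" and X: "adapted F T X" and Y: "martingale P F T Y"
    and t: "0 \<le> t" "t \<le> T" and c: "0 < c" "c \<le> 1" and m: "0 \<le> m" and \<epsilon>: "0 < \<epsilon>" and N: "0 < N"
  shows "measure P {\<omega> \<in> space P. (\<forall>i\<le>N. \<bar>Y (grid t N i) \<omega>\<bar> \<le> m) \<and> \<epsilon> < \<bar>play_transform X Y c t N \<omega>\<bar>}
    \<le> c * ((m\<^sup>2 + (2 * \<epsilon> + 2 * m) * (\<integral>\<omega>. \<bar>Y t \<omega>\<bar> \<partial>P)) / \<epsilon>\<^sup>2)"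
proof -
  interpret prob_space P using P by (simp add: filtered_prob_space_def)
  interpret filtration "space P" F using P by (simp add: filtered_prob_space_def)
  have sub: "subalgebra P (F s)" for s using P by (simp add: filtered_prob_space_def)
  have mono: "subalgebra (F u) (F s)" if "s \<le> u" for s u
    using sets_F_mono[OF that] space_F by (simp add: subalgebra_def)
  have mem: "grid t N i \<in> {0..T}" if "i \<le> N" for i using grid_mem[OF t(1) that] t(2) by auto
  define h where "h i \<omega> = 2 * (X (grid t N i) \<omega> - play (c / 2) (\<lambda>i. X (grid t N i) \<omega>) i)" for i \<omega>
  have hc: "\<bar>h i \<omega>\<bar> \<le> c" for i \<omega>
    using play_close[of "c / 2" "\<lambda>i. X (grid t N i) \<omega>" i] c unfolding h_def abs_mult by simp
  have Xm: "X (grid t N i) \<in> borel_measurable (F (grid t N i))" if "i \<le> N" for i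
    using X mem[OF that] by (auto simp: adapted_def)
  have hm: "h i \<in> borel_measurable (F (grid t N i))" if "i < N" for i
  proof -
    have [measurable]: "X (grid t N i) \<in> borel_measurable (F (grid t N i))"
      using that by (intro Xm) simp
    have [measurable]: "(\<lambda>\<omega>. play (c / 2) (\<lambda>i. X (grid t N i) \<omega>) i) \<in> borel_measurable (F (grid t N i))"
      using that by (intro measurable_play[where n = N and G = "\<lambda>i. F (grid t N i)"] mono grid_mono t Xm) auto
    show ?thesis unfolding h_def[abs_def] by measurable
  qed
  have "prob {\<omega> \<in> space P. (\<forall>i\<le>N. \<bar>Y (grid t N i) \<omega>\<bar> \<le> m) \<and>
      \<epsilon> < \<bar>\<Sum>i<N. h i \<omega> * (Y (grid t N (Suc i)) \<omega> - Y (grid t N i) \<omega>)\<bar>}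
    \<le> (c\<^sup>2 * m\<^sup>2 + (2 * c * \<epsilon> + 2 * c\<^sup>2 * m) * expectation (\<lambda>\<omega>. \<bar>Y (grid t N N) \<omega>\<bar>)) / \<epsilon>\<^sup>2"
  proof (rule martingale_transform_prob_le[where G = "\<lambda>i. F (grid t N i)"])
    fix i assume i: "i \<le> N"
    show "Y (grid t N i) \<in> borel_measurable (F (grid t N i))" "integrable P (Y (grid t N i))"
      using Y mem[OF i] by (auto simp: martingale_def adapted_def)
    fix \<zeta> :: "'a \<Rightarrow> real" and C assume "\<zeta> \<in> borel_measurable (F (grid t N i))" "\<And>\<omega>. \<bar>\<zeta> \<omega>\<bar> \<le> C"
    then show "expectation (\<lambda>\<omega>. \<zeta> \<omega> * Y (grid t N N) \<omega>) = expectation (\<lambda>\<omega>. \<zeta> \<omega> * Y (grid t N i) \<omega>)"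
      using mem[OF i] mem[of N] grid_mono[OF t(1) i]
      by (intro martingale_expectation_mult[OF P Y]) auto
  qed (use sub mono grid_mono[OF t(1)] hm hc \<epsilon> m in auto)
  also have "\<dots> \<le> (c * m\<^sup>2 + c * (2 * \<epsilon> + 2 * m) * expectation (\<lambda>\<omega>. \<bar>Y t \<omega>\<bar>)) / \<epsilon>\<^sup>2"
  proof -
    have "c\<^sup>2 \<le> c" using c by (simp add: power2_eq_square mult_left_le)
    then have 1: "c\<^sup>2 * m\<^sup>2 \<le> c * m\<^sup>2" and 2: "2 * c * \<epsilon> + 2 * c\<^sup>2 * m \<le> c * (2 * \<epsilon> + 2 * m)"
      using m by (auto intro: mult_right_mono simp: distrib_left)
    have "0 \<le> expectation (\<lambda>\<omega>. \<bar>Y t \<omega>\<bar>)" by simp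
    from add_mono[OF 1 mult_right_mono[OF 2 this]] show ?thesis
      unfolding grid_last[OF N] by (rule divide_right_mono) simp
  qed
  also have "\<dots> = c * ((m\<^sup>2 + (2 * \<epsilon> + 2 * m) * (\<integral>\<omega>. \<bar>Y t \<omega>\<bar> \<partial>P)) / \<epsilon>\<^sup>2)"
    by (simp add: algebra_simps)
  finally show ?thesis by (simp add: play_transform_def h_def)
qed

text \<open>
  For each level, with a probability that is summable over the levels, all but finitely many grids
  are bad. Convergence of the sums of squares in probability is enough here, since it is the
  lower limit over the grids of the probabilities of a bad grid that counts.
\<close>

lemma AE_frequently_good_grid:
  assumes P: "filtered_prob_space P F" and X: "adapted F T X" and Y: "martingale P F T Y"
    and Q: "is_quadratic_variation P T X Q"
    and t: "0 \<le> t" "t \<le> T" and m: "0 \<le> m" and \<epsilon>: "0 < \<epsilon>"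
    and c: "\<And>k. 0 < c k" "\<And>k. c k \<le> 1" "summable c"
  shows "AE \<omega> in P. \<forall>\<^sub>F k in sequentially. \<exists>\<^sub>F N in sequentially.
    \<bar>grid_squares X t N \<omega> - Q t \<omega>\<bar> \<le> \<epsilon> \<and>
    ((\<forall>i\<le>N. \<bar>Y (grid t N i) \<omega>\<bar> \<le> m) \<longrightarrow> \<bar>play_transform X Y (c k) t N \<omega>\<bar> \<le> \<epsilon>)"
proof -
  interpret prob_space P using P by (simp add: filtered_prob_space_def)
  interpret filtration "space P" F using P by (simp add: filtered_prob_space_def)
  have sub: "subalgebra P (F s)" for s using P by (simp add: filtered_prob_space_def)
  have mem: "grid t N i \<in> {0..T}" if "i \<le> N" for i N using grid_mem[OF t(1) that] t(2) by auto
  have Xm[measurable]: "X (grid t N i) \<in> borel_measurable P" if "i \<le> N" for N i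
    using X mem[OF that] by (intro measurable_from_subalg[OF sub]) (auto simp: adapted_def)
  have Ym[measurable]: "Y (grid t N i) \<in> borel_measurable P" if "i \<le> N" for N i
    using Y mem[OF that] by (auto simp: martingale_def)
  have Qm[measurable]: "Q t \<in> borel_measurable P" using Q t by (auto simp: is_quadratic_variation_def)
  define A where "A N = {\<omega> \<in> space P. \<epsilon> < \<bar>grid_squares X t N \<omega> - Q t \<omega>\<bar>}" for N
  define B where "B k N = {\<omega> \<in> space P. (\<forall>i\<le>N. \<bar>Y (grid t N i) \<omega>\<bar> \<le> m) \<and>
      \<epsilon> < \<bar>play_transform X Y (c k) t N \<omega>\<bar>}" for k N
  have A: "A N \<in> events" for N
  proof -
    have [measurable]: "grid_squares X t N \<in> borel_measurable P"
      unfolding grid_squares_def[abs_def]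
      by (intro borel_measurable_sum borel_measurable_power borel_measurable_diff Xm) auto
    show ?thesis unfolding A_def by measurable
  qed
  have B: "B k N \<in> events" for k N
  proof -
    have [measurable]: "play_transform X Y (c k) t N \<in> borel_measurable P"
      unfolding play_transform_def[abs_def]
      by (intro borel_measurable_sum borel_measurable_times borel_measurable_diff borel_measurable_const Xm Ym
          measurable_play[where n = N and G = "\<lambda>_. P"]) (auto simp: subalgebra_def)
    have "Measurable.pred P (\<lambda>\<omega>. \<forall>i\<in>{..N}. \<bar>Y (grid t N i) \<omega>\<bar> \<le> m)"
      by (intro pred_intros_finite) auto
    then have [measurable]: "Measurable.pred P (\<lambda>\<omega>. \<forall>i\<le>N. \<bar>Y (grid t N i) \<omega>\<bar> \<le> m)"
      by (simp add: Ball_def)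
    show ?thesis unfolding B_def by measurable
  qed
  define K where "K = (m\<^sup>2 + (2 * \<epsilon> + 2 * m) * expectation (\<lambda>\<omega>. \<bar>Y t \<omega>\<bar>)) / \<epsilon>\<^sup>2"
  have AN: "\<forall>\<^sub>F N in sequentially. prob (A N) < \<eta>" if \<eta>: "0 < \<eta>" for \<eta>
  proof -
    have "\<forall>t\<in>{0..T}. \<forall>\<epsilon>>0. \<forall>\<eta>>0. \<exists>\<delta>>0. \<forall>n p.
       time_partition t n p \<and> (\<forall>i<n. p (Suc i) - p i < \<delta>) \<longrightarrow>
       measure P {\<omega> \<in> space P.
         \<bar>(\<Sum>i<n. (X (p (Suc i)) \<omega> - X (p i) \<omega>)\<^sup>2) - Q t \<omega>\<bar> > \<epsilon>} < \<eta>"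
      using Q unfolding is_quadratic_variation_def by (elim conjE)
    moreover have "t \<in> {0..T}" using t by simp
    ultimately obtain \<delta> where \<delta>: "0 < \<delta>" "\<forall>n p.
       time_partition t n p \<and> (\<forall>i<n. p (Suc i) - p i < \<delta>) \<longrightarrow>
       measure P {\<omega> \<in> space P.
         \<bar>(\<Sum>i<n. (X (p (Suc i)) \<omega> - X (p i) \<omega>)\<^sup>2) - Q t \<omega>\<bar> > \<epsilon>} < \<eta>"
      using \<epsilon> \<eta> by blast
    have "(\<lambda>N. t / real N) \<longlonglongrightarrow> 0" by (rule lim_const_over_n)
    then have "\<forall>\<^sub>F N in sequentially. t / real N < \<delta>" using \<delta> by (intro order_tendstoD) auto
    then show ?thesis using eventually_gt_at_top[of 0]
    proof eventually_elim
      case (elim N)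
      have "time_partition t N (grid t N)"
        using elim t by (auto simp: time_partition_def intro: grid_mono)
      moreover have "\<forall>i<N. grid t N (Suc i) - grid t N i < \<delta>"
        using elim by (simp add: grid_step)
      ultimately show ?case
        using \<delta>(2) unfolding A_def grid_squares_def by blast
    qed
  qed
  have "\<forall>\<^sub>F N in sequentially. prob (A N \<union> B k N) \<le> c k * (1 + K)" for k
    using AN[OF c(1)[of k]] eventually_gt_at_top[of 0]
  proof eventually_elim
    case (elim N)
    have "prob (A N \<union> B k N) \<le> prob (A N) + prob (B k N)"
      by (rule measure_Un_le[OF A B])
    also have "prob (B k N) \<le> c k * K"
      unfolding B_def K_def using elim by (intro play_transform_prob_le[OF P X Y t c(1,2) m \<epsilon>])
    finally show ?case using elim by (simp add: distrib_left)
  qed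
  from prob_eventually_le[OF sets.Un[OF A B] this]
  have E: "{\<omega> \<in> space P. \<forall>\<^sub>F N in sequentially. \<omega> \<in> A N \<union> B k N} \<in> events" 
      "prob {\<omega> \<in> space P. \<forall>\<^sub>F N in sequentially. \<omega> \<in> A N \<union> B k N} \<le> c k * (1 + K)" for k by auto
  have "AE \<omega> in P. \<forall>\<^sub>F k in sequentially.
      \<omega> \<in> space P - {\<omega> \<in> space P. \<forall>\<^sub>F N in sequentially. \<omega> \<in> A N \<union> B k N}"
  proof (rule borel_cantelli_AE1)
    show "summable (\<lambda>k. prob {\<omega> \<in> space P. \<forall>\<^sub>F N in sequentially. \<omega> \<in> A N \<union> B k N})"
      by (rule summable_comparison_test'[OF summable_mult2[OF c(3), of "1 + K"]]) (use E in auto)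
  qed (use E in \<open>auto simp: emeasure_eq_measure\<close>)
  then show ?thesis
  proof (rule AE_mp, intro AE_I2 impI)
    fix \<omega> assume \<omega>: "\<omega> \<in> space P"
    assume "\<forall>\<^sub>F k in sequentially.
      \<omega> \<in> space P - {\<omega> \<in> space P. \<forall>\<^sub>F N in sequentially. \<omega> \<in> A N \<union> B k N}"
    then show "\<forall>\<^sub>F k in sequentially. \<exists>\<^sub>F N in sequentially.
      \<bar>grid_squares X t N \<omega> - Q t \<omega>\<bar> \<le> \<epsilon> \<and>
      ((\<forall>i\<le>N. \<bar>Y (grid t N i) \<omega>\<bar> \<le> m) \<longrightarrow> \<bar>play_transform X Y (c k) t N \<omega>\<bar> \<le> \<epsilon>)"
    proof eventually_elim
      case (elim k)
      then have "\<exists>\<^sub>F N in sequentially. \<not> \<omega> \<in> A N \<union> B k N"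
        using \<omega> by (simp add: not_eventually)
      then show ?case
        by (rule frequently_elim1) (use \<omega> in \<open>auto simp: A_def B_def not_less\<close>)
    qed
  qed
qed

lemma tendsto_of_eventually_near:
  fixes v err :: "nat \<Rightarrow> real"
  assumes err: "err \<longlonglongrightarrow> 0"
    and near: "\<And>j. \<forall>\<^sub>F k in sequentially. \<bar>v k - L\<bar> \<le> 3 * (1 / real (Suc j)) + err k"
  shows "v \<longlonglongrightarrow> L"
proof (rule tendstoI)
  fix e :: real assume e: "0 < e"
  then obtain j where j: "1 / real (Suc j) < e / 6"
    using reals_Archimedean[of "e / 6"] by (auto simp: inverse_eq_divide)
  have "\<forall>\<^sub>F k in sequentially. err k < e / 2" using err e by (intro order_tendstoD) auto
  then show "\<forall>\<^sub>F k in sequentially. dist (v k) L < e"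
    using near[of j] by eventually_elim (use j in \<open>simp add: dist_real_def\<close>)
qed

text \<open>
  Almost every path of \<open>M\<close> is bounded by some \<open>m\<close> for which, moreover, \<open>\<tau> m = T\<close>; there \<open>M\<close> agrees
  with the martingale obtained by stopping at \<open>\<tau> m\<close>, to which \<open>AE_frequently_good_grid\<close> applies with
  the bound \<open>m\<close>. The same \<open>m\<close> indexes the localizing sequence and the bound, so that countably many
  exceptional null sets suffice.
\<close>

lemma AE_tendsto_at_fixed_time:
  assumes P: "filtered_prob_space P F"
    and dec: "continuous_semimartingale_decomposition P F T X M A"
    and Q: "is_quadratic_variation P T X Q" and t: "0 \<le> t" "t \<le> T"
    and c: "\<And>k. 0 < c k" "\<And>k. c k \<le> 1" "summable c"
  shows "AE \<omega> in P.
    (\<lambda>k. c k * TV (c k) (\<lambda>s. X s \<omega>) 0 t) \<longlonglongrightarrow> Q t \<omega> \<and>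
    (\<lambda>k. c k * UTV (c k) (\<lambda>s. X s \<omega>) 0 t) \<longlonglongrightarrow> Q t \<omega> / 2 \<and>
    (\<lambda>k. c k * DTV (c k) (\<lambda>s. X s \<omega>) 0 t) \<longlonglongrightarrow> Q t \<omega> / 2"
proof -
  have X: "adapted F T X" "continuous_paths P T X"
    and MA: "continuous_local_martingale P F T M" "continuous_finite_variation_process P F T A"
    and XMA: "AE \<omega> in P. \<forall>t\<in>{0..T}. X t \<omega> = X 0 \<omega> + M t \<omega> + A t \<omega>"
    using dec unfolding continuous_semimartingale_decomposition_def by - (elim conjE, assumption)+
  have M: "continuous_paths P T M"
    using MA(1) unfolding continuous_local_martingale_def by (elim conjE)
  have A: "\<forall>\<omega>\<in>space P. finite_variation_on (\<lambda>t. A t \<omega>) 0 T"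
    using MA(2) unfolding continuous_finite_variation_process_def by (elim conjE)
  have "\<exists>\<tau>. localizing_sequence P F T \<tau> \<and>
      (\<forall>n. martingale P F T (\<lambda>t \<omega>. M (min t (\<tau> n \<omega>)) \<omega>))"
    using MA(1) unfolding continuous_local_martingale_def by (elim conjE)
  then obtain \<tau> where \<tau>: "localizing_sequence P F T \<tau>"
    and mart: "\<And>n. martingale P F T (\<lambda>t \<omega>. M (min t (\<tau> n \<omega>)) \<omega>)"
    by blast
  define Y where "Y n t \<omega> = M (min t (\<tau> n \<omega>)) \<omega>" for n t \<omega>
  have good: "AE \<omega> in P. \<forall>j m. \<forall>\<^sub>F k in sequentially. \<exists>\<^sub>F N in sequentially.
    \<bar>grid_squares X t N \<omega> - Q t \<omega>\<bar> \<le> 1 / real (Suc j) \<and>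
    ((\<forall>i\<le>N. \<bar>Y m (grid t N i) \<omega>\<bar> \<le> real m) \<longrightarrow> \<bar>play_transform X (Y m) (c k) t N \<omega>\<bar> \<le> 1 / real (Suc j))"
    unfolding AE_all_countable
    by (intro allI AE_frequently_good_grid[OF P X(1) _ Q t _ _ c] mart[folded Y_def]) auto
  have "AE \<omega> in P. \<forall>\<^sub>F n in sequentially. \<tau> n \<omega> = T"
    using \<tau> unfolding localizing_sequence_def by (elim conjE)
  with good XMA show ?thesis using AE_space[of P]
  proof eventually_elim
    case (elim \<omega>)
    note good = elim(1) and XMA = elim(2) and \<tau>T = elim(3) and \<omega> = elim(4)
    define f where "f = (\<lambda>s. X s \<omega>)"
    have fT: "continuous_on {0..T} f" using X(2) \<omega> by (simp add: continuous_paths_def f_def)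
    have f: "continuous_on {0..t} f" using fT t by (auto intro: continuous_on_subset)
    have bounded: "\<exists>b. \<forall>s\<in>{0..T}. \<bar>g s\<bar> \<le> b" if "continuous_on {0..T} g" for g :: "real \<Rightarrow> real"
      using compact_imp_bounded[OF compact_continuous_image[OF that compact_Icc]]
      by (auto simp: bounded_iff)
    obtain R where R: "\<And>s. s \<in> {0..T} \<Longrightarrow> \<bar>f s\<bar> \<le> R" using bounded[OF fT] by blast
    have "continuous_on {0..T} (\<lambda>s. M s \<omega>)" using M \<omega> by (simp add: continuous_paths_def)
    from bounded[OF this] obtain b where b: "\<And>s. s \<in> {0..T} \<Longrightarrow> \<bar>M s \<omega>\<bar> \<le> b" by blast
    have "\<forall>\<^sub>F n in sequentially. b \<le> real n"
      using filterlim_real_sequentially by (simp add: filterlim_at_top)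
    with \<tau>T have "\<forall>\<^sub>F n in sequentially. b \<le> real n \<and> \<tau> n \<omega> = T" by eventually_elim simp
    then obtain m where m: "b \<le> real m" "\<tau> m \<omega> = T"
      using eventually_happens'[OF sequentially_bot] by blast
    have YM: "Y m s \<omega> = M s \<omega>" if "s \<in> {0..T}" for s using that m by (simp add: Y_def)
    define V where "V = enn2real (truncated_variation 0 (\<lambda>s. A s \<omega>) 0 T)"
    have V: "(\<Sum>i<N. \<bar>A (grid t N (Suc i)) \<omega> - A (grid t N i) \<omega>\<bar>) \<le> V" for N
      unfolding V_def using A \<omega> t by (intro grid_variation_le) auto
    define err where "err k = c k * V + c k * R + 4 * (c k)\<^sup>2" for k
    have near: "\<forall>\<^sub>F k in sequentially.
        \<bar>c k * TV (c k) f 0 t - Q t \<omega>\<bar> \<le> 3 * (1 / real (Suc j)) + err k \<and>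
        \<bar>c k * UTV (c k) f 0 t - Q t \<omega> / 2\<bar> \<le> 3 * (1 / real (Suc j)) + err k \<and>
        \<bar>c k * DTV (c k) f 0 t - Q t \<omega> / 2\<bar> \<le> 3 * (1 / real (Suc j)) + err k" for j
      using good[rule_format, of j m]
    proof eventually_elim
      case (elim k)
      then have "\<exists>\<^sub>F N in sequentially.
        \<bar>(\<Sum>i<N. (f (grid t N (Suc i)) - f (grid t N i))\<^sup>2) - Q t \<omega>\<bar> \<le> 1 / real (Suc j) \<and>
        \<bar>\<Sum>i<N. 2 * (f (grid t N i) - play (c k / 2) (\<lambda>i. f (grid t N i)) i) *
          (M (grid t N (Suc i)) \<omega> - M (grid t N i) \<omega>)\<bar> \<le> 1 / real (Suc j)"
      proof (rule frequently_elim1)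
        fix N
        assume N: "\<bar>grid_squares X t N \<omega> - Q t \<omega>\<bar> \<le> 1 / real (Suc j) \<and>
          ((\<forall>i\<le>N. \<bar>Y m (grid t N i) \<omega>\<bar> \<le> real m) \<longrightarrow>
            \<bar>play_transform X (Y m) (c k) t N \<omega>\<bar> \<le> 1 / real (Suc j))"
        have mem: "grid t N i \<in> {0..T}" if "i \<le> N" for i using grid_mem[OF t(1) that] t(2) by auto
        have "\<forall>i\<le>N. \<bar>Y m (grid t N i) \<omega>\<bar> \<le> real m"
        proof (intro allI impI)
          fix i assume "i \<le> N"
          from YM[OF mem[OF this]] b[OF mem[OF this]] m(1)
          show "\<bar>Y m (grid t N i) \<omega>\<bar> \<le> real m" by simp
        qed
        moreover have "play_transform X (Y m) (c k) t N \<omega> =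
          (\<Sum>i<N. 2 * (f (grid t N i) - play (c k / 2) (\<lambda>i. f (grid t N i)) i) *
            (M (grid t N (Suc i)) \<omega> - M (grid t N i) \<omega>))"
          unfolding play_transform_def f_def
        proof (rule sum.cong)
          fix i assume "i \<in> {..<N}"
          then have "i \<le> N" "Suc i \<le> N" by simp_all
          note YM[OF mem[OF this(1)]] YM[OF mem[OF this(2)]]
          then show "2 * (X (grid t N i) \<omega> - play (c k / 2) (\<lambda>i. X (grid t N i) \<omega>) i) *
              (Y m (grid t N (Suc i)) \<omega> - Y m (grid t N i) \<omega>) =
            2 * (X (grid t N i) \<omega> - play (c k / 2) (\<lambda>i. X (grid t N i) \<omega>) i) *
              (M (grid t N (Suc i)) \<omega> - M (grid t N i) \<omega>)" by (simp only:)
        qed simp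
        ultimately show "\<bar>(\<Sum>i<N. (f (grid t N (Suc i)) - f (grid t N i))\<^sup>2) - Q t \<omega>\<bar> \<le> 1 / real (Suc j) \<and>
          \<bar>\<Sum>i<N. 2 * (f (grid t N i) - play (c k / 2) (\<lambda>i. f (grid t N i)) i) *
            (M (grid t N (Suc i)) \<omega> - M (grid t N i) \<omega>)\<bar> \<le> 1 / real (Suc j)"
          using N unfolding grid_squares_def f_def by simp
      qed
      moreover have "f s = f 0 + M s \<omega> + A s \<omega>" if "s \<in> {0..t}" for s
      proof -
        have "s \<in> {0..T}" using that t by simp
        from bspec[OF XMA this] show ?thesis by (simp only: f_def)
      qed
      moreover have "\<bar>f s\<bar> \<le> R" if "s \<in> {0..t}" for s using R[of s] that t by simp
      moreover have "0 < 1 / real (Suc j)" by simp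
      ultimately have "\<bar>c k * TV (c k) f 0 t - Q t \<omega>\<bar> \<le> 3 * (1 / real (Suc j)) + c k * V + c k * R + 4 * (c k)\<^sup>2 \<and>
        \<bar>c k * UTV (c k) f 0 t - Q t \<omega> / 2\<bar> \<le> 3 * (1 / real (Suc j)) + c k * V + c k * R + 4 * (c k)\<^sup>2 \<and>
        \<bar>c k * DTV (c k) f 0 t - Q t \<omega> / 2\<bar> \<le> 3 * (1 / real (Suc j)) + c k * V + c k * R + 4 * (c k)\<^sup>2"
        using V by (intro conjI semimartingale_path_near[OF c(1)[of k] t(1) f, where m = "\<lambda>s. M s \<omega>"
            and a = "\<lambda>s. A s \<omega>"])
      then show ?case by (simp only: err_def add.assoc)
    qed
    have "c \<longlonglongrightarrow> 0" using c(3) by (rule summable_LIMSEQ_zero)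
    then have "err \<longlonglongrightarrow> 0 * V + 0 * R + 4 * 0\<^sup>2"
      unfolding err_def by (intro tendsto_intros)
    then have err: "err \<longlonglongrightarrow> 0" by simp
    show ?case
      unfolding f_def[symmetric]
      by (intro conjI tendsto_of_eventually_near[OF err] eventually_mono[OF near]) auto
  qed
qed

section \<open>Passing to all levels and all times\<close>

text \<open>
  For \<open>c\<close> between two consecutive levels, monotonicity of \<open>W\<close> confines \<open>c * W c\<close> between its values
  at these levels, up to the ratio of the levels, which tends to \<open>1\<close>.
\<close>

lemma tendsto_at_right_of_inverse_squares:
  fixes W :: "real \<Rightarrow> real"
  assumes anti: "\<And>c d. 0 < c \<Longrightarrow> c \<le> d \<Longrightarrow> W d \<le> W c" and nonneg: "\<And>c. 0 \<le> W c"
    and lim: "(\<lambda>k. 1 / (real (Suc k))\<^sup>2 * W (1 / (real (Suc k))\<^sup>2)) \<longlonglongrightarrow> q"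
  shows "((\<lambda>c. c * W c) \<longlongrightarrow> q) (at_right 0)"
proof -
  define v where "v k = 1 / (real (Suc k))\<^sup>2 * W (1 / (real (Suc k))\<^sup>2)" for k
  define \<kappa> where "\<kappa> c = nat \<lfloor>1 / sqrt c\<rfloor> - 1" for c
  have v: "v \<longlonglongrightarrow> q" using lim by (simp add: v_def[abs_def])
  have r: "(\<lambda>k. (real (Suc k) / real (Suc (Suc k)))\<^sup>2) \<longlonglongrightarrow> 1\<^sup>2"
    "(\<lambda>k. (real (Suc (Suc k)) / real (Suc k))\<^sup>2) \<longlonglongrightarrow> 1\<^sup>2"
    by (intro tendsto_power LIMSEQ_Suc[OF LIMSEQ_n_over_Suc_n] LIMSEQ_Suc[OF LIMSEQ_Suc_n_over_n])+
  have lo: "(\<lambda>k. v k * (real (Suc k) / real (Suc (Suc k)))\<^sup>2) \<longlonglongrightarrow> q"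
    using tendsto_mult[OF v r(1)] by simp
  have hi: "(\<lambda>k. v (Suc k) * (real (Suc (Suc k)) / real (Suc k))\<^sup>2) \<longlonglongrightarrow> q"
    using tendsto_mult[OF LIMSEQ_Suc[OF v] r(2)] by simp
  have \<kappa>: "filterlim \<kappa> at_top (at_right 0)"
    unfolding filterlim_at_top
  proof
    fix Z :: nat
    have "\<forall>\<^sub>F c in at_right (0::real). c < 1 / (real (Suc Z))\<^sup>2"
      by (intro order_tendstoD(2)[OF tendsto_ident_at]) simp
    then show "\<forall>\<^sub>F c in at_right 0. Z \<le> \<kappa> c"
      using eventually_at_right_less[of 0]
    proof eventually_elim
      case (elim c)
      then have "sqrt c < sqrt (1 / (real (Suc Z))\<^sup>2)" by (simp only: real_sqrt_less_iff)
      then have "sqrt c < 1 / real (Suc Z)" by (simp only: real_sqrt_divide real_sqrt_abs real_sqrt_one abs_of_nat)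
      then have "real (Suc Z) \<le> 1 / sqrt c" using elim by (simp add: field_simps)
      then have "int (Suc Z) \<le> \<lfloor>1 / sqrt c\<rfloor>" by (simp only: le_floor_iff of_int_of_nat_eq)
      then show ?case by (simp add: \<kappa>_def)
    qed
  qed
  have ev: "\<forall>\<^sub>F c in at_right (0::real). 0 < c \<and> c \<le> 1"
    using eventually_at_right_less[of "0::real"] order_tendstoD(2)[OF tendsto_ident_at, of "0::real" 1 "{0<..}"]
    by (auto elim: eventually_elim2)
  have bounds: "v (\<kappa> c) * (real (Suc (\<kappa> c)) / real (Suc (Suc (\<kappa> c))))\<^sup>2 \<le> c * W c \<and>
      c * W c \<le> v (Suc (\<kappa> c)) * (real (Suc (Suc (\<kappa> c))) / real (Suc (\<kappa> c)))\<^sup>2"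
    if c: "0 < c" "c \<le> 1" for c
  proof -
    define s where "s = 1 / sqrt c"
    define n where "n = Suc (\<kappa> c)"
    have s: "1 \<le> s" "c = 1 / s\<^sup>2" using c by (auto simp: s_def power_divide)
    then have "1 \<le> \<lfloor>s\<rfloor>" by simp
    then have "real n = real_of_int \<lfloor>s\<rfloor>" by (simp add: n_def \<kappa>_def s_def[symmetric] of_nat_diff)
    moreover have "real_of_int \<lfloor>s\<rfloor> \<le> s" "s < real_of_int \<lfloor>s\<rfloor> + 1" using floor_correct[of s] by simp_all
    ultimately have "real n \<le> s" "s \<le> real n + 1" by linarith+
    then have n: "0 < n" "real n \<le> s" "s \<le> real (Suc n)" by (simp_all add: n_def)
    have c1: "c \<le> 1 / (real n)\<^sup>2" "1 / (real (Suc n))\<^sup>2 \<le> c"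
      unfolding s(2) using n s(1) by (auto intro!: divide_left_mono power_mono mult_pos_pos)
    have p: "0 < 1 / (real (Suc n))\<^sup>2" by simp
    have "1 / (real (Suc n))\<^sup>2 * W (1 / (real n)\<^sup>2) \<le> c * W c"
      using mult_mono[OF c1(2) anti[OF c(1) c1(1)] less_imp_le[OF c(1)] nonneg] .
    moreover have "c * W c \<le> 1 / (real n)\<^sup>2 * W (1 / (real (Suc n))\<^sup>2)"
      using mult_mono[OF c1(1) anti[OF p c1(2)] _ nonneg] by simp
    moreover have "v (\<kappa> c) * (real n / real (Suc n))\<^sup>2 = 1 / (real (Suc n))\<^sup>2 * W (1 / (real n)\<^sup>2)"
      using n(1) by (simp add: v_def n_def[symmetric] power_divide del: of_nat_Suc)
    moreover have "v (Suc (\<kappa> c)) * (real (Suc n) / real n)\<^sup>2 = 1 / (real n)\<^sup>2 * W (1 / (real (Suc n))\<^sup>2)"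
      using n(1) by (simp add: v_def n_def[symmetric] power_divide del: of_nat_Suc)
    ultimately show ?thesis by (simp add: n_def[symmetric] del: of_nat_Suc)
  qed
  show ?thesis
  proof (rule tendsto_sandwich)
    show "((\<lambda>c. v (\<kappa> c) * (real (Suc (\<kappa> c)) / real (Suc (Suc (\<kappa> c))))\<^sup>2) \<longlongrightarrow> q) (at_right 0)"
      using filterlim_compose[OF lo \<kappa>] .
    show "((\<lambda>c. v (Suc (\<kappa> c)) * (real (Suc (Suc (\<kappa> c))) / real (Suc (\<kappa> c)))\<^sup>2) \<longlongrightarrow> q) (at_right 0)"
      using filterlim_compose[OF hi \<kappa>] .
  qed (use ev bounds in \<open>auto elim!: eventually_mono\<close>)
qed

text \<open>
  The argument of Polya: on a grid on whose cells \<open>q\<close> hardly varies, monotonicity squeezes the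
  functions between their values at the ends of a cell.
\<close>

lemma uniform_limit_of_monotone:
  fixes g :: "'b \<Rightarrow> real \<Rightarrow> real"
  assumes T: "0 < T" and q: "continuous_on {0..T} q"
    and mono: "\<forall>\<^sub>F c in F. \<forall>x\<in>{0..T}. \<forall>y\<in>{0..T}. x \<le> y \<longrightarrow> g c x \<le> g c y"
    and lim: "\<And>n i. i \<le> n \<Longrightarrow> ((\<lambda>c. g c (grid T n i)) \<longlongrightarrow> q (grid T n i)) F"
  shows "uniform_limit {0..T} g q F"
  unfolding uniform_limit_iff
proof (intro allI impI)
  fix e :: real assume e: "0 < e"
  have "uniformly_continuous_on {0..T} q"
    using q compact_uniformly_continuous by blast
  then obtain d where d: "d > 0"
      "\<And>x y. x \<in> {0..T} \<Longrightarrow> y \<in> {0..T} \<Longrightarrow> dist y x < d \<Longrightarrow> dist (q y) (q x) < e / 2"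
    using e unfolding uniformly_continuous_on_def by (metis half_gt_zero)
  obtain k where "inverse (real (Suc k)) < d / T"
    using reals_Archimedean[of "d / T"] T d by auto
  moreover define n where "n = Suc k"
  ultimately have n: "0 < n" "T / real n < d"
    using T by (simp_all add: field_simps)
  have "\<forall>\<^sub>F c in F. \<forall>i\<in>{..n}. dist (g c (grid T n i)) (q (grid T n i)) < e / 2"
    using e by (intro eventually_ball_finite ballI tendstoD[OF lim]) auto
  with mono show "\<forall>\<^sub>F c in F. \<forall>x\<in>{0..T}. dist (g c x) (q x) < e"
  proof eventually_elim
    case (elim c)
    show ?case
    proof
      fix x assume x: "x \<in> {0..T}"
      obtain i where i: "i < n" "grid T n i \<le> x" "x \<le> grid T n (Suc i)"
      proof -
        define k where "k = (LEAST k. x \<le> grid T n k)"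
        have xn: "x \<le> grid T n n" using x n by simp
        have k: "x \<le> grid T n k" "k \<le> n"
          unfolding k_def using xn by (rule LeastI, rule Least_le)
        show ?thesis
        proof (cases k)
          case 0
          then have "x = 0" using k x by simp
          then show ?thesis using that[of 0] n T by (simp add: grid_def)
        next
          case (Suc i)
          then have "\<not> x \<le> grid T n i" using not_less_Least[of i "\<lambda>k. x \<le> grid T n k"] by (simp add: k_def)
          then show ?thesis using that[of i] k Suc by simp
        qed
      qed
      have mem: "grid T n i \<in> {0..T}" "grid T n (Suc i) \<in> {0..T}"
        using i T by (auto intro!: grid_mem simp del: atLeastAtMost_iff)
      have "dist (grid T n i) x < d" "dist (grid T n (Suc i)) x < d"
        using i n grid_step[of T n i] by (auto simp: dist_real_def)
      then have "dist (q (grid T n i)) (q x) < e / 2" "dist (q (grid T n (Suc i))) (q x) < e / 2"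
        using d(2) x mem by auto
      moreover have "dist (g c (grid T n i)) (q (grid T n i)) < e / 2"
        "dist (g c (grid T n (Suc i))) (q (grid T n (Suc i))) < e / 2"
        using elim(2) i by auto
      moreover have "g c (grid T n i) \<le> g c x" "g c x \<le> g c (grid T n (Suc i))"
        using elim(1) x mem i by auto
      ultimately show "dist (g c x) (q x) < e"
        unfolding dist_real_def by linarith
    qed
  qed
qed

theorem theorem1:
  fixes P :: "'a measure" and F :: "real \<Rightarrow> 'a measure" and T :: real
    and X M A Q :: "real \<Rightarrow> 'a \<Rightarrow> real"
  assumes "0 < T"
    and "filtered_prob_space P F"
    and "continuous_semimartingale_decomposition P F T X M A"
    and "is_quadratic_variation P T X Q"
  shows "AE \<omega> in P.
    uniform_limit {0..T} (\<lambda>c t. c * enn2real (truncated_variation c (\<lambda>s. X s \<omega>) 0 t))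
      (\<lambda>t. Q t \<omega>) (at_right 0) \<and>
    uniform_limit {0..T} (\<lambda>c t. c * enn2real (up_truncated_variation c (\<lambda>s. X s \<omega>) 0 t))
      (\<lambda>t. 1/2 * Q t \<omega>) (at_right 0) \<and>
    uniform_limit {0..T} (\<lambda>c t. c * enn2real (down_truncated_variation c (\<lambda>s. X s \<omega>) 0 t))
      (\<lambda>t. 1/2 * Q t \<omega>) (at_right 0)"
proof -
  define c where "c k = 1 / (real (Suc k))\<^sup>2" for k
  have c: "0 < c k" "c k \<le> 1" for k by (auto simp: c_def)
  have "summable (\<lambda>k. 1 / (real k)\<^sup>2)"
    using inverse_power_summable[of 2, where 'a = real] by (simp add: inverse_eq_divide)
  then have cs: "summable c" by (simp only: c_def[abs_def] summable_Suc_iff[of "\<lambda>k. 1 / (real k)\<^sup>2"])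
  have "AE \<omega> in P. \<forall>n i. i \<le> n \<longrightarrow>
    (\<lambda>k. c k * TV (c k) (\<lambda>s. X s \<omega>) 0 (grid T n i)) \<longlonglongrightarrow> Q (grid T n i) \<omega> \<and>
    (\<lambda>k. c k * UTV (c k) (\<lambda>s. X s \<omega>) 0 (grid T n i)) \<longlonglongrightarrow> Q (grid T n i) \<omega> / 2 \<and>
    (\<lambda>k. c k * DTV (c k) (\<lambda>s. X s \<omega>) 0 (grid T n i)) \<longlonglongrightarrow> Q (grid T n i) \<omega> / 2"
    unfolding AE_all_countable
  proof (intro allI)
    fix n i
    show "AE \<omega> in P. i \<le> n \<longrightarrow>
    (\<lambda>k. c k * TV (c k) (\<lambda>s. X s \<omega>) 0 (grid T n i)) \<longlonglongrightarrow> Q (grid T n i) \<omega> \<and>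
    (\<lambda>k. c k * UTV (c k) (\<lambda>s. X s \<omega>) 0 (grid T n i)) \<longlonglongrightarrow> Q (grid T n i) \<omega> / 2 \<and>
    (\<lambda>k. c k * DTV (c k) (\<lambda>s. X s \<omega>) 0 (grid T n i)) \<longlonglongrightarrow> Q (grid T n i) \<omega> / 2"
    proof (cases "i \<le> n")
      case True
      then have "grid T n i \<in> {0..T}" using assms(1) by (intro grid_mem) auto
      then show ?thesis
        using AE_tendsto_at_fixed_time[OF assms(2-4) _ _ c cs, of "grid T n i"] by auto
    qed simp
  qed
  then show ?thesis using AE_space[of P]
  proof eventually_elim
    case (elim \<omega>)
    define f where "f = (\<lambda>s. X s \<omega>)"
    have "continuous_paths P T X" "continuous_paths P T Q"
      using assms(3,4) unfolding continuous_semimartingale_decomposition_def is_quadratic_variation_def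
      by - (elim conjE, assumption)+
    then have f: "continuous_on {0..T} f" and Q: "continuous_on {0..T} (\<lambda>t. Q t \<omega>)"
      using elim(2) by (auto simp: f_def continuous_paths_def)
    have ft: "continuous_on {0..t} f" "continuous_on {0..t} (\<lambda>x. - f x)" if "t \<le> T" for t
      using f that by (auto intro: continuous_on_subset continuous_on_minus)
    note lim = elim(1)[rule_format, folded f_def]
    have pos: "\<forall>\<^sub>F c in at_right (0::real). 0 < c" by (rule eventually_at_right_less)
    have gT: "grid T n i \<le> T" if "i \<le> n" for n i
      using grid_mem[of T i n] that assms(1) by simp
    show ?case
      unfolding f_def[symmetric]
    proof (intro conjI uniform_limit_of_monotone assms(1) Q continuous_on_mult_left)
      show "\<forall>\<^sub>F c in at_right 0. \<forall>x\<in>{0..T}. \<forall>y\<in>{0..T}. x \<le> y \<longrightarrow> c * TV c f 0 x \<le> c * TV c f 0 y"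
        using pos by eventually_elim (auto intro!: mult_left_mono TV_mono ft)
      show "\<forall>\<^sub>F c in at_right 0. \<forall>x\<in>{0..T}. \<forall>y\<in>{0..T}. x \<le> y \<longrightarrow> c * UTV c f 0 x \<le> c * UTV c f 0 y"
        using pos by eventually_elim (auto intro!: mult_left_mono UTV_mono ft)
      show "\<forall>\<^sub>F c in at_right 0. \<forall>x\<in>{0..T}. \<forall>y\<in>{0..T}. x \<le> y \<longrightarrow> c * DTV c f 0 x \<le> c * DTV c f 0 y"
        using pos unfolding DTV_eq_UTV by eventually_elim (auto intro!: mult_left_mono UTV_mono ft)
      fix n i :: nat assume i: "i \<le> n"
      show "((\<lambda>c. c * TV c f 0 (grid T n i)) \<longlongrightarrow> Q (grid T n i) \<omega>) (at_right 0)"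
        using lim[OF i, unfolded c_def] gT[OF i]
        by (intro tendsto_at_right_of_inverse_squares TV_antimono ft) auto
      show "((\<lambda>c. c * UTV c f 0 (grid T n i)) \<longlongrightarrow> 1 / 2 * Q (grid T n i) \<omega>) (at_right 0)"
        using lim[OF i, unfolded c_def] gT[OF i]
        by (intro tendsto_at_right_of_inverse_squares UTV_antimono ft) auto
      show "((\<lambda>c. c * DTV c f 0 (grid T n i)) \<longlongrightarrow> 1 / 2 * Q (grid T n i) \<omega>) (at_right 0)"
        using lim[OF i, unfolded c_def] gT[OF i] unfolding DTV_eq_UTV
        by (intro tendsto_at_right_of_inverse_squares UTV_antimono ft) auto
    qed
  qed
qed

end
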